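(* Let $f:[0,1]^2\to\mathbb R_{\ge 0}$ be continuous and let $u:[0,1]^2\to\mathbb R$ be the value function $$u(\bm x)=\sup_{\bm\varphi\in\mathcal A(\bm x)}\int_0^1 f(\varphi_1(t),\varphi_2(t))\sqrt{\varphi_1'(t)\varphi_2'(t)}\,dt .$$ Assume that the set $A$ satisfies the conditions (A1), (A2) and that the approximations $g_h$, $h=1/N$, $N\in\mathbb N$, satisfy the conditions (G1)–(G4) listed in the context. Then the scheme $$u_h(\bm x)=\max_{\bm\alpha\in A}\Bigl[h f(\bm x)\sqrt{\alpha_1\alpha_2}+\sqrt{h^2f(\bm x)^2\alpha_1\alpha_2+g_h(\bm x,\bm\alpha,u_h)^2}\Bigr],\qquad \bm x\in[0,1]_h^2\cap(0,1]^2,$$ with boundary values $u_h(\bm x)=0$ whenever $x_1=0$ or $x_2=0$, is convergent: its solution $u_h:[0,1]_h^2\to\mathbb R$ satisfies $$\lim_{h\to0}\ \max_{\bm x\in[0,1]_h^2}|u_h(\bm x)-u(\bm x)|=0 .$$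
   Context: Notation: $\bm x=(x_1,x_2)$, $\bm\alpha=(\alpha_1,\alpha_2)$; $|\cdot|$ is the Euclidean norm. For $h=1/N$, $[0,1]_h^2=\{0,h,2h,\dots,1\}^2$. Admissible paths: $\mathcal A(\bm x)$ is the set of absolutely continuous $\bm\varphi=(\varphi_1,\varphi_2):[0,1]\to\mathbb R^2$ with $\bm\varphi(0)=\bm 0$, $\bm\varphi(1)=\bm x$, and $\varphi_1'(s),\varphi_2'(s)\ge0$ for a.e. $s$. The value function $u$ vanishes where $x_1=0$ or $x_2=0$, and it is the unique viscosity solution of the Hamilton–Jacobi–Bellman equation $\sup_{\bm\alpha\in A}\bigl(-Du(\bm x)\cdot\bm\alpha+f(\bm x)\sqrt{\alpha_1\alpha_2}\bigr)=0$ in $(0,1]^2$ with these boundary values; the scheme comes from a discretisation of this equation in which $Du$ is replaced by $D(u^2)/(2u)$. Conditions on $A$: (A1) $A\subset\mathbb R_{\ge0}^2$, the closed cone generated by $A$, i.e. the closure of $\{\lambda\bm\alpha:\lambda\ge0,\ \bm\alpha\in A\}$, equals $\mathbb R_{\ge0}^2$, and $\inf_{\bm\alpha\in A}|\bm\alpha|>0$. (A2) $A$ is compact. Conditions on $g_h$: for each $h$, $g_h$ assigns a real number $g_h(\bm x,\bm\alpha,\psi)$, meant as an approximation of $\psi(\bm x-h\bm\alpha)$, to each $\bm x\in[0,1]_h^2$, $\bm\alpha\in A$ and each real-valued function $\psi$ on the grid $[0,1]_h^2$ (functions on $[0,1]^2$ are restricted to the grid), such that: (G1) $g_h$ is monotone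 non-decreasing in its function argument: $\psi\le\xi$ implies $g_h(\bm x,\bm\alpha,\psi)\le g_h(\bm x,\bm\alpha,\xi)$. (G2) $g_h$ is localised: there exists $C>0$ such that, for all functions $\psi,\xi:[0,1]^2\to\mathbb R$ that satisfy $\psi=\xi$ on the ball $B_{Ch}(\bm x)$ of radius $Ch$ centred at $\bm x$, we have $g_h(\bm x,\bm\alpha,\psi)=g_h(\bm x,\bm\alpha,\xi)$. (G3) If $\psi\equiv\psi_0$ is constant, then $g_h(\bm x,\bm\alpha,\psi)=\psi_0$. (G4) $g_h$ is a superlinear approximation: for every $\psi\in C^\infty([0,1]^2)$ and all $L>0$ there exists a modulus of continuity $\omega_{\psi,L}$ such that, for every constant $\xi$ with $|\xi|\le L$, $$\left|\frac{g_h(\bm x,\bm\alpha,\psi+\xi)-\psi(\bm x-h\bm\alpha)-\xi}{h}\right|\le\omega_{\psi,L}(h).$$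
   Formalization: For each h the scheme is assumed to have exactly one solution u_h (its max read as a supremum), which (G1)–(G4) do not imply; (G4) is imposed at grid points of (0,1]^2 with ψ smooth on the whole plane, which forces A into [0,1]^2. *)

theory Defs
  imports "HOL-Analysis.Analysis"
begin

definition unit_square :: "(real \<times> real) set" where
  "unit_square = {0..1} \<times> {0..1}"

definition quadrant :: "(real \<times> real) set" where
  "quadrant = {0..} \<times> {0..}"

definition abs_continuous_on :: "real \<Rightarrow> real \<Rightarrow> (real \<Rightarrow> 'a::real_normed_vector) \<Rightarrow> bool" where
  "abs_continuous_on c d \<phi> \<longleftrightarrow>
     (\<forall>\<epsilon>>0. \<exists>\<delta>>0. \<forall>(n::nat) a b.
        (\<forall>i<n. c \<le> a i \<and> a i \<le> b i \<and> b i \<le> d) \<longrightarrow>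
        disjoint_family_on (\<lambda>i. {a i<..<b i}) {..<n} \<longrightarrow>
        (\<Sum>i<n. b i - a i) < \<delta> \<longrightarrow>
        (\<Sum>i<n. norm (\<phi> (b i) - \<phi> (a i))) < \<epsilon>)"

text \<open>An absolutely continuous path is differentiable almost everywhere, so asking for the
  existence of the derivative in the last condition excludes no path.\<close>

definition admissible_paths :: "real \<times> real \<Rightarrow> (real \<Rightarrow> real \<times> real) set" where
  "admissible_paths x = {\<phi>. abs_continuous_on 0 1 \<phi> \<and> \<phi> 0 = 0 \<and> \<phi> 1 = x \<and>
     (AE s in lebesgue. s \<in> {0..1} \<longrightarrow>
        (\<exists>v. (\<phi> has_vector_derivative v) (at s) \<and> 0 \<le> fst v \<and> 0 \<le> snd v))}"

definition path_reward :: "(real \<times> real \<Rightarrow> real) \<Rightarrow> (real \<Rightarrow> real \<times> real) \<Rightarrow> real" where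
  "path_reward f \<phi> =
     (LINT t:{0..1}|lebesgue.
        f (\<phi> t) * sqrt (fst (vector_derivative \<phi> (at t)) * snd (vector_derivative \<phi> (at t))))"

definition value_fun :: "(real \<times> real \<Rightarrow> real) \<Rightarrow> real \<times> real \<Rightarrow> real" where
  "value_fun f x = (SUP \<phi>\<in>admissible_paths x. path_reward f \<phi>)"

definition cond_A1 :: "(real \<times> real) set \<Rightarrow> bool" where
  "cond_A1 A \<longleftrightarrow> A \<subseteq> quadrant
     \<and> closure {l *\<^sub>R \<alpha> | l \<alpha>. 0 \<le> l \<and> \<alpha> \<in> A} = quadrant
     \<and> 0 < (INF \<alpha>\<in>A. norm \<alpha>)"

definition cond_A2 :: "(real \<times> real) set \<Rightarrow> bool" where
  "cond_A2 A \<longleftrightarrow> compact A"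

definition mesh :: "nat \<Rightarrow> real" where
  "mesh N = 1 / real N"

definition grid :: "nat \<Rightarrow> (real \<times> real) set" where
  "grid N = {(real i * mesh N, real j * mesh N) | i j. i \<le> N \<and> j \<le> N}"

definition inner_grid :: "nat \<Rightarrow> (real \<times> real) set" where
  "inner_grid N = grid N \<inter> ({0<..1} \<times> {0<..1})"

text \<open>A family of approximations is indexed by \<open>N\<close>, with \<open>h = mesh N = 1 / N\<close>.
  Grid functions are represented by total functions on the plane. The first condition compares
  them on the grid only, so (by antisymmetry) it also forces the value of \<open>g\<close> to depend
  on nothing but the restriction of its last argument to the grid.\<close>

type_synonym approximations =
  "nat \<Rightarrow> real \<times> real \<Rightarrow> real \<times> real \<Rightarrow> (real \<times> real \<Rightarrow> real) \<Rightarrow> real"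

definition cond_G1 :: "(real \<times> real) set \<Rightarrow> approximations \<Rightarrow> bool" where
  "cond_G1 A g \<longleftrightarrow>
     (\<forall>N\<ge>1. \<forall>x\<in>grid N. \<forall>\<alpha>\<in>A. \<forall>\<psi> \<xi>.
        (\<forall>y\<in>grid N. \<psi> y \<le> \<xi> y) \<longrightarrow> g N x \<alpha> \<psi> \<le> g N x \<alpha> \<xi>)"

definition cond_G2 :: "(real \<times> real) set \<Rightarrow> approximations \<Rightarrow> bool" where
  "cond_G2 A g \<longleftrightarrow>
     (\<exists>C>0. \<forall>N\<ge>1. \<forall>x\<in>grid N. \<forall>\<alpha>\<in>A. \<forall>\<psi> \<xi>.
        (\<forall>y\<in>unit_square \<inter> ball x (C * mesh N). \<psi> y = \<xi> y) \<longrightarrow> g N x \<alpha> \<psi> = g N x \<alpha> \<xi>)"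

definition cond_G3 :: "(real \<times> real) set \<Rightarrow> approximations \<Rightarrow> bool" where
  "cond_G3 A g \<longleftrightarrow> (\<forall>N\<ge>1. \<forall>x\<in>grid N. \<forall>\<alpha>\<in>A. \<forall>c. g N x \<alpha> (\<lambda>_. c) = c)"

primrec C_diff :: "nat \<Rightarrow> (real \<times> real \<Rightarrow> real) \<Rightarrow> bool" where
  "C_diff 0 \<psi> \<longleftrightarrow> continuous_on UNIV \<psi>"
| "C_diff (Suc k) \<psi> \<longleftrightarrow>
     (\<exists>p q. (\<forall>x. (\<psi> has_derivative (\<lambda>v. p x * fst v + q x * snd v)) (at x)) \<and>
            C_diff k p \<and> C_diff k q)"

definition smooth :: "(real \<times> real \<Rightarrow> real) \<Rightarrow> bool" where
  "smooth \<psi> \<longleftrightarrow> (\<forall>k. C_diff k \<psi>)"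

definition modulus_of_continuity :: "(real \<Rightarrow> real) \<Rightarrow> bool" where
  "modulus_of_continuity \<omega> \<longleftrightarrow>
     mono_on {0..} \<omega> \<and> \<omega> 0 = 0 \<and> (\<omega> \<longlongrightarrow> 0) (at_right 0)"

text \<open>A smooth function on the closed unit square is the restriction of a smooth function on
  the plane, so the test functions \<open>\<psi>\<close> range over the latter. The estimate is imposed at
  the points where the scheme is posed. It cannot be imposed for \<open>x\<close> on the axes:
  there \<open>x - h \<alpha>\<close> leaves the square for some \<open>\<alpha>\<close>, and for \<open>\<psi> = fst\<close> or \<open>\<psi> = snd\<close>
  the estimate would contradict monotonicity together with exactness on constants.\<close>

definition cond_G4 :: "(real \<times> real) set \<Rightarrow> approximations \<Rightarrow> bool" where
  "cond_G4 A g \<longleftrightarrow>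
     (\<forall>\<psi>. smooth \<psi> \<longrightarrow> (\<forall>L>0. \<exists>\<omega>. modulus_of_continuity \<omega> \<and>
        (\<forall>\<xi>. \<bar>\<xi>\<bar> \<le> L \<longrightarrow> (\<forall>N\<ge>1. \<forall>x\<in>inner_grid N. \<forall>\<alpha>\<in>A.
           \<bar>(g N x \<alpha> (\<lambda>y. \<psi> y + \<xi>) - \<psi> (x - mesh N *\<^sub>R \<alpha>) - \<xi>) / mesh N\<bar>
             \<le> \<omega> (mesh N)))))"

text \<open>The maximum over \<open>A\<close> is written as a supremum, since nothing is assumed on how
  \<open>g\<close> depends on \<open>\<alpha>\<close>; the two agree whenever the maximum is attained.\<close>

definition scheme_solution ::
  "(real \<times> real \<Rightarrow> real) \<Rightarrow> (real \<times> real) set \<Rightarrow> approximations \<Rightarrow> nat \<Rightarrow> (real \<times> real \<Rightarrow> real) \<Rightarrow> bool"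
  where
  "scheme_solution f A g N v \<longleftrightarrow>
     (\<forall>x\<in>inner_grid N.
        v x = (SUP \<alpha>\<in>A. mesh N * f x * sqrt (fst \<alpha> * snd \<alpha>)
                 + sqrt ((mesh N)\<^sup>2 * (f x)\<^sup>2 * fst \<alpha> * snd \<alpha> + (g N x \<alpha> v)\<^sup>2))) \<and>
     (\<forall>x\<in>grid N. fst x = 0 \<or> snd x = 0 \<longrightarrow> v x = 0)"

definition the_scheme_solution ::
  "(real \<times> real \<Rightarrow> real) \<Rightarrow> (real \<times> real) set \<Rightarrow> approximations \<Rightarrow> nat \<Rightarrow> (real \<times> real \<Rightarrow> real) \<Rightarrow> bool"
  where
  "the_scheme_solution f A g N v \<longleftrightarrow>
     scheme_solution f A g N v \<and>
     (\<forall>w. scheme_solution f A g N w \<longrightarrow> (\<forall>x\<in>grid N. w x = v x))"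

end

theory Submission
  imports Defs
begin

text \<open>Both inequalities between \<open>u\<^sub>h\<close> and \<open>u\<close> come from doubling the variables with a quadratic penalty
  \<open>K \<bar>x - y\<bar>\<^sup>2 + \<delta> (x\<^sub>1 + x\<^sub>2)\<close>. In \<open>x\<close>, monotonicity and consistency of the scheme turn the penalty into a
  test function touching \<open>u\<^sub>h\<close> and bound its slopes \<open>p \<cdot> \<alpha>\<close> in terms of \<open>f(x) \<surd>(\<alpha>\<^sub>1 \<alpha>\<^sub>2)\<close>. In \<open>y\<close>, no viscosity
  theory is needed: appending a segment to a path shows that \<open>u\<close> grows at least like
  \<open>t f \<surd>(\<alpha>\<^sub>1 \<alpha>\<^sub>2)\<close> along \<open>t \<alpha>\<close>, and cutting off the last piece of a nearly optimal path gives an increment along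
  which \<open>u\<close> grows at most so fast. The term in \<open>\<delta>\<close> makes the two slope estimates contradictory.
  Uniform bounds on \<open>u\<^sub>h\<close>, in particular near the axes, come from linear supersolutions: below each of
  them the monotone scheme has a fixed point, which is \<open>u\<^sub>h\<close> by uniqueness.\<close>

section \<open>Absolutely continuous paths\<close>

text \<open>The modulus in \<open>cond_G4\<close> depends on the test function, and in a doubling
  argument the centre \<open>y\<close> of the penalty moves with \<open>N\<close>, so consistency is
  not uniform over all penalties that occur. Hence \<open>y\<close> ranges over a coarse
  \<open>grid n\<close> with \<open>n\<close> fixed before \<open>N\<close>. Its rounding error must
  remain small after division by the length scale \<open>t\<close> of an increment, which dictates
  the order in which the constants are chosen. Rounding is directed: since the value function is
  monotone, rounding down in one inequality and up in the other changes only the penalty for the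
  worse. The two inequalities are not symmetric. An upper bound for the solution must control sqrt
  (a^2 + b^2) with a of order h; this exceeds b by only O(h^2) where the solution stays away from 0,
  hence the need for bounds near the axes. For the lower bound sqrt (a^2 + b^2) \<ge> b suffices,
  but the scheme sees only directions in \<open>A\<close>, while the last piece of a nearly optimal
  path may point anywhere in the quadrant; homogeneity and the closed cone in \<open>cond_A1\<close>
  bridge this gap.\<close>

lemma abs_continuous_onE:
  assumes "abs_continuous_on c d \<phi>" "\<epsilon> > 0"
  obtains \<delta> where "\<delta> > 0" "\<And>(n::nat) a b. \<lbrakk>\<forall>i<n. c \<le> a i \<and> a i \<le> b i \<and> b i \<le> d;
      disjoint_family_on (\<lambda>i. {a i<..<b i}) {..<n}; (\<Sum>i<n. b i - a i) < \<delta>\<rbrakk>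
      \<Longrightarrow> (\<Sum>i<n. norm (\<phi> (b i) - \<phi> (a i))) < \<epsilon>"
proof -
  from assms obtain \<delta> where "\<delta> > 0" and \<delta>: "\<forall>(n::nat) a b. (\<forall>i<n. c \<le> a i \<and> a i \<le> b i \<and> b i \<le> d) \<longrightarrow>
      disjoint_family_on (\<lambda>i. {a i<..<b i}) {..<n} \<longrightarrow> (\<Sum>i<n. b i - a i) < \<delta> \<longrightarrow>
      (\<Sum>i<n. norm (\<phi> (b i) - \<phi> (a i))) < \<epsilon>"
    unfolding abs_continuous_on_def by blast
  show ?thesis
    by (rule that[OF \<open>\<delta> > 0\<close>]) (use \<delta> in blast)
qed

text \<open>Absolute continuity speaks of numbered families of intervals, a gauge argument produces
  a finite set of tagged ones. Enumerating the set connects the two: non-overlapping pieces inside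
  \<open>U\<close> have total length at most the measure of \<open>U\<close>, hence below
  \<open>\<delta>\<close>.\<close>

lemma disjoint_intervals_abs_continuous:
  assumes ac: "\<And>(n::nat) a b. \<lbrakk>\<forall>i<n. c \<le> a i \<and> a i \<le> b i \<and> b i \<le> d;
        disjoint_family_on (\<lambda>i. {a i<..<b i}) {..<n}; (\<Sum>i<n. b i - a i) < \<delta>\<rbrakk>
        \<Longrightarrow> (\<Sum>i<n. norm (\<phi> (b i) - \<phi> (a i))) < \<epsilon>"
    and "open U" "U \<in> lmeasurable" and U: "measure lebesgue U < \<delta>"
    and q: "finite q" "\<And>x K. (x, K) \<in> q \<Longrightarrow> \<exists>u v. K = {u..v} \<and> u \<le> v \<and> c \<le> u \<and> v \<le> d \<and> K \<subseteq> U"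
    and disj: "\<And>x1 K1 x2 K2. \<lbrakk>(x1, K1) \<in> q; (x2, K2) \<in> q; (x1, K1) \<noteq> (x2, K2)\<rbrakk>
        \<Longrightarrow> interior K1 \<inter> interior K2 = {}"
  shows "(\<Sum>(x, K)\<in>q. norm (\<phi> (Sup K) - \<phi> (Inf K))) < \<epsilon>"
proof -
  obtain h where h: "bij_betw h {..<card q} q"
    using ex_bij_betw_nat_finite[OF q(1)] by (auto simp: atLeast0LessThan)
  define a where "a i = Inf (snd (h i))" for i
  define b where "b i = Sup (snd (h i))" for i
  have hq: "h i \<in> q" if "i < card q" for i
    using h that by (auto simp: bij_betw_def)
  have hi: "a i \<le> b i \<and> c \<le> a i \<and> b i \<le> d \<and> snd (h i) = {a i..b i} \<and> {a i..b i} \<subseteq> U"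
    if "i < card q" for i
  proof -
    have "(fst (h i), snd (h i)) \<in> q" using hq[OF that] by simp
    from q(2)[OF this] obtain u v where "snd (h i) = {u..v}" "u \<le> v" "c \<le> u" "v \<le> d" "snd (h i) \<subseteq> U"
      by blast
    then show ?thesis by (simp add: a_def b_def)
  qed
  have dis: "disjoint_family_on (\<lambda>i. {a i<..<b i}) {..<card q}"
  proof (clarsimp simp only: disjoint_family_on_def lessThan_iff)
    fix m n assume mn: "m < card q" "n < card q" "m \<noteq> n"
    then have "h m \<noteq> h n" using h by (auto simp: bij_betw_def inj_on_def)
    then have "interior (snd (h m)) \<inter> interior (snd (h n)) = {}"
      using disj[of "fst (h m)" "snd (h m)" "fst (h n)" "snd (h n)"] hq mn by simp
    then show "{a m<..<b m} \<inter> {a n<..<b n} = {}"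
      using hi mn by simp
  qed
  have "(\<Sum>i<card q. b i - a i) = (\<Sum>i<card q. measure lebesgue {a i<..<b i})"
    using hi by (intro sum.cong) auto
  also have "\<dots> = measure lebesgue (\<Union>i<card q. {a i<..<b i})"
    using dis hi by (intro measure_finite_Union[symmetric]) (auto simp: emeasure_lborel_Ioo)
  also have "\<dots> \<le> measure lebesgue U"
    using hi \<open>U \<in> lmeasurable\<close> by (intro measure_mono_fmeasurable) (auto, meson atLeastAtMost_iff less_imp_le subsetD)
  also have "\<dots> < \<delta>" by (rule U)
  finally have "(\<Sum>i<card q. norm (\<phi> (b i) - \<phi> (a i))) < \<epsilon>"
    using ac[of "card q" a b] hi dis by blast
  moreover have "(\<Sum>i<card q. norm (\<phi> (b i) - \<phi> (a i)))
      = (\<Sum>z\<in>q. norm (\<phi> (Sup (snd z)) - \<phi> (Inf (snd z))))"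
    unfolding a_def b_def by (rule sum.reindex_bij_betw[OF h])
  ultimately show ?thesis by (simp add: case_prod_unfold)
qed

text \<open>The gauge is given by the derivative off the exceptional null set, and by a small open
  neighbourhood on that set, where absolute continuity controls the increments.\<close>

lemma abs_continuous_has_integral:
  fixes \<phi> :: "real \<Rightarrow> 'a::banach"
  assumes ac: "abs_continuous_on c d \<phi>" and ab: "c \<le> a" "a \<le> b" "b \<le> d"
    and S: "negligible S"
    and der: "\<And>x. x \<in> {a..b} - S \<Longrightarrow> (\<phi> has_vector_derivative \<phi>' x) (at x)"
  shows "(\<phi>' has_integral (\<phi> b - \<phi> a)) {a..b}"
proof -
  \<comment> \<open>Resetting the derivative to 0 on \<open>S\<close> leaves only increments of
    \<open>\<phi>\<close> to be estimated at tags in \<open>S\<close>; the spike step at the end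
    restores \<open>\<phi>'\<close>.\<close>
  define \<phi>0 where "\<phi>0 x = (if x \<in> S then 0 else \<phi>' x)" for x
  have "(\<phi>0 has_integral (\<phi> b - \<phi> a)) {a..b}"
    unfolding has_integral_real
  proof (intro allI impI)
    fix e :: real assume "e > 0"
    \<comment> \<open>Half of \<open>e\<close> is spent on tags outside \<open>S\<close>, half on
      tags in \<open>S\<close>. The summand 1 keeps the denominator positive when
      \<open>a = b\<close>.\<close>
    define e1 where "e1 = e / (2 * (b - a + 1))"
    have e1: "e1 > 0" "e1 * (b - a) \<le> e / 2"
      using \<open>e > 0\<close> ab by (auto simp: e1_def field_simps)
    have "\<forall>x. \<exists>\<delta>>0. x \<in> {a..b} - S \<longrightarrow>
         (\<forall>y. norm (y-x) < \<delta> \<longrightarrow> norm (\<phi> y - \<phi> x - (y-x) *\<^sub>R \<phi>' x) \<le> e1 * norm (y-x))"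
      using der e1(1) unfolding has_vector_derivative_def has_derivative_at_alt
      by (metis zero_less_one)
    then obtain \<delta> where \<delta>: "\<And>x. 0 < \<delta> x" and \<delta>': "\<And>x y. \<lbrakk>x \<in> {a..b} - S; norm (y-x) < \<delta> x\<rbrakk>
                        \<Longrightarrow> norm (\<phi> y - \<phi> x - (y-x) *\<^sub>R \<phi>' x) \<le> e1 * norm (y-x)"
      by metis
    obtain d0 where "d0 > 0" and d0: "\<And>(n::nat) a b. \<lbrakk>\<forall>i<n. c \<le> a i \<and> a i \<le> b i \<and> b i \<le> d;
        disjoint_family_on (\<lambda>i. {a i<..<b i}) {..<n}; (\<Sum>i<n. b i - a i) < d0\<rbrakk>
        \<Longrightarrow> (\<Sum>i<n. norm (\<phi> (b i) - \<phi> (a i))) < e / 2"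
      by (rule abs_continuous_onE[OF ac half_gt_zero[OF \<open>e > 0\<close>]]) (rule that, assumption, blast)
    obtain U where U: "open U" "S \<subseteq> U" "U \<in> lmeasurable" "measure lebesgue U < d0"
    proof -
      have "S \<in> lmeasurable" "measure lebesgue S = 0"
        using S by (simp_all add: negligible_imp_measurable negligible_imp_measure0)
      then obtain T where T: "open T" "S \<subseteq> T" "T - S \<in> lmeasurable" "emeasure lebesgue (T - S) < ennreal d0"
        using sets_lebesgue_outer_open[of S d0] \<open>d0 > 0\<close> fmeasurableD by blast
      have "T = S \<union> (T - S)" using T by auto
      then have "T \<in> lmeasurable" using \<open>S \<in> lmeasurable\<close> T(3) by (metis fmeasurable.Un)
      moreover have "measure lebesgue T < d0"
      proof -
        have "measure lebesgue (T - S) = measure lebesgue T"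
          using S \<open>T \<in> lmeasurable\<close> by (simp add: measure_Diff_null_set negligible_iff_null_sets fmeasurableD)
        moreover have "measure lebesgue (T - S) < d0"
          using T(3,4) \<open>d0 > 0\<close> by (simp add: emeasure_eq_measure2 ennreal_less_iff)
        ultimately show ?thesis by simp
      qed
      ultimately show ?thesis using that T by blast
    qed
    define \<gamma> where "\<gamma> x = (if x \<in> S then U else ball x (\<delta> x))" for x
    show "\<exists>\<gamma>. gauge \<gamma> \<and> (\<forall>\<D>. \<D> tagged_division_of {a..b} \<and> \<gamma> fine \<D> \<longrightarrow>
         norm ((\<Sum>(x, k)\<in>\<D>. measure lborel k *\<^sub>R \<phi>0 x) - (\<phi> b - \<phi> a)) < e)"
    proof (intro exI[of _ \<gamma>] conjI allI impI)
      show "gauge \<gamma>" using U \<delta> by (auto simp: gauge_def \<gamma>_def)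
      fix p assume "p tagged_division_of {a..b} \<and> \<gamma> fine p"
      then have p: "p tagged_division_of {a..b}" and fine: "\<gamma> fine p" by auto
      note pD = tagged_division_ofD[OF p]
      have K: "\<exists>u v. K = {u..v} \<and> u \<le> v \<and> x \<in> K \<and> a \<le> u \<and> v \<le> b \<and> K \<subseteq> \<gamma> x" if "(x, K) \<in> p" for x K
      proof -
        have "\<exists>u v. K = {u..v}" using pD(4)[OF that] by simp
        then obtain u v where "K = {u..v}" by blast
        moreover have "x \<in> K" "K \<subseteq> {a..b}" using pD that by auto
        moreover have "K \<subseteq> \<gamma> x" using fine that by (auto simp: fine_def)
        ultimately show ?thesis by auto
      qed
      define q where "q = {z \<in> p. fst z \<in> S}"
      have q: "q \<subseteq> p" "finite q" using pD(1) by (auto simp: q_def)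
      have "norm ((\<Sum>(x, k)\<in>p. measure lborel k *\<^sub>R \<phi>0 x) - (\<phi> b - \<phi> a))
         = norm (\<Sum>(x,k)\<in>p. measure lborel k *\<^sub>R \<phi>0 x - (\<phi> (Sup k) - \<phi> (Inf k)))"
        unfolding additive_tagged_division_1[OF ab(2) p, of \<phi>, symmetric]
        by (simp add: sum_subtractf case_prod_unfold)
      also have "\<dots> \<le> (\<Sum>(x,k)\<in>p. norm (measure lborel k *\<^sub>R \<phi>0 x - (\<phi> (Sup k) - \<phi> (Inf k))))"
        by (simp add: case_prod_unfold norm_sum)
      also have "\<dots> = (\<Sum>(x,k)\<in>p - q. norm (measure lborel k *\<^sub>R \<phi>0 x - (\<phi> (Sup k) - \<phi> (Inf k))))
          + (\<Sum>(x,k)\<in>q. norm (measure lborel k *\<^sub>R \<phi>0 x - (\<phi> (Sup k) - \<phi> (Inf k))))"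
        by (rule sum.subset_diff[OF q(1) pD(1)])
      also have "(\<Sum>(x,k)\<in>q. norm (measure lborel k *\<^sub>R \<phi>0 x - (\<phi> (Sup k) - \<phi> (Inf k))))
          = (\<Sum>(x,k)\<in>q. norm (\<phi> (Sup k) - \<phi> (Inf k)))"
        by (intro sum.cong) (auto simp: q_def \<phi>0_def norm_minus_commute)
      also have "\<dots> < e / 2"
      proof (rule disjoint_intervals_abs_continuous[OF d0 U(1,3,4) q(2)])
        fix x K assume "(x, K) \<in> q"
        then have "(x, K) \<in> p" "x \<in> S" by (auto simp: q_def)
        with K[of x K] ab show "\<exists>u v. K = {u..v} \<and> u \<le> v \<and> c \<le> u \<and> v \<le> d \<and> K \<subseteq> U"
          by (auto simp: \<gamma>_def)
      qed (use pD(5) q(1) in blast)+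
      also have "(\<Sum>(x,k)\<in>p - q. norm (measure lborel k *\<^sub>R \<phi>0 x - (\<phi> (Sup k) - \<phi> (Inf k))))
         \<le> (\<Sum>(x,k)\<in>p - q. e1 * (Sup k - Inf k))"
      proof (rule sum_mono, clarify)
        fix x k assume xk: "(x, k) \<in> p" "(x, k) \<notin> q"
        then obtain u v where uv: "k = {u..v}" "u \<le> v" "x \<in> k" "a \<le> u" "v \<le> b" "k \<subseteq> \<gamma> x"
          using K by blast
        have "x \<notin> S" using xk by (auto simp: q_def)
        then have x: "x \<in> {a..b} - S" "k \<subseteq> ball x (\<delta> x)" "\<phi>0 x = \<phi>' x"
          using uv by (auto simp: \<gamma>_def \<phi>0_def)
        have "u \<in> ball x (\<delta> x)" "v \<in> ball x (\<delta> x)" using x(2) uv(1,2) by auto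
        then have uv': "norm (u - x) < \<delta> x" "norm (v - x) < \<delta> x"
          by (simp_all add: dist_norm norm_minus_commute)
        \<comment> \<open>The tag \<open>x\<close> lies between \<open>u\<close> and
          \<open>v\<close>, so the two one-sided errors add up to
          \<open>e1 * (v - u)\<close>.\<close>
        have "norm ((v - u) *\<^sub>R \<phi>' x - (\<phi> v - \<phi> u))
            = norm (\<phi> u - \<phi> x - (u - x) *\<^sub>R \<phi>' x - (\<phi> v - \<phi> x - (v - x) *\<^sub>R \<phi>' x))"
          by (auto simp: algebra_simps)
        also have "\<dots> \<le> e1 * norm (u - x) + e1 * norm (v - x)"
          using norm_triangle_ineq4 \<delta>'[OF x(1) uv'(1)] \<delta>'[OF x(1) uv'(2)]
          by (meson add_mono order_trans)
        also have "\<dots> = e1 * (v - u)" using uv by (auto simp: algebra_simps)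
        finally show "norm (measure lborel k *\<^sub>R \<phi>0 x - (\<phi> (Sup k) - \<phi> (Inf k))) \<le> e1 * (Sup k - Inf k)"
          using uv x(3) by simp
      qed
      also have "\<dots> \<le> (\<Sum>(x,k)\<in>p. e1 * (Sup k - Inf k))"
      proof (rule sum_mono2[OF pD(1)])
        fix z assume "z \<in> p - (p - q)"
        then have "(fst z, snd z) \<in> p" by auto
        from K[OF this] show "0 \<le> (case z of (x, k) \<Rightarrow> e1 * (Sup k - Inf k))"
          using e1 by (auto simp: case_prod_unfold)
      qed auto
      also have "\<dots> = e1 * (b - a)"
        using additive_tagged_division_1[OF ab(2) p, of "\<lambda>x. x"]
        by (simp add: case_prod_unfold flip: sum_distrib_left)
      finally show "norm ((\<Sum>(x, k)\<in>p. measure lborel k *\<^sub>R \<phi>0 x) - (\<phi> b - \<phi> a)) < e"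
        using e1(2) by linarith
    qed
  qed
  then show ?thesis
    by (rule has_integral_spike[OF S, rotated]) (simp add: \<phi>0_def)
qed

lemma abs_continuous_on_imp_continuous_on:
  assumes "abs_continuous_on c d \<phi>"
  shows "continuous_on {c..d} \<phi>"
  unfolding continuous_on_iff
proof (intro ballI allI impI)
  fix x \<epsilon> :: real assume "x \<in> {c..d}" "\<epsilon> > 0"
  obtain \<delta> where "\<delta> > 0" and \<delta>: "\<And>(n::nat) a b. \<lbrakk>\<forall>i<n. c \<le> a i \<and> a i \<le> b i \<and> b i \<le> d;
      disjoint_family_on (\<lambda>i. {a i<..<b i}) {..<n}; (\<Sum>i<n. b i - a i) < \<delta>\<rbrakk> \<Longrightarrow>
      (\<Sum>i<n. norm (\<phi> (b i) - \<phi> (a i))) < \<epsilon>"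
    by (rule abs_continuous_onE[OF assms \<open>\<epsilon> > 0\<close>]) (rule that, assumption, blast)
  have "dist (\<phi> y) (\<phi> x) < \<epsilon>" if "y \<in> {c..d}" "dist y x < \<delta>" for y
  proof (cases "x \<le> y")
    case True
    then show ?thesis
      using \<delta>[of 1 "\<lambda>_. x" "\<lambda>_. y"] that \<open>x \<in> {c..d}\<close>
      by (simp add: disjoint_family_on_def dist_norm)
  next
    case False
    then show ?thesis
      using \<delta>[of 1 "\<lambda>_. y" "\<lambda>_. x"] that \<open>x \<in> {c..d}\<close>
      by (simp add: disjoint_family_on_def dist_norm norm_minus_commute)
  qed
  then show "\<exists>\<delta>>0. \<forall>y\<in>{c..d}. dist y x < \<delta> \<longrightarrow> dist (\<phi> y) (\<phi> x) < \<epsilon>"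
    using \<open>\<delta> > 0\<close> by blast
qed

lemma abs_continuous_on_add:
  assumes "abs_continuous_on c d \<phi>" "abs_continuous_on c d \<zeta>"
  shows "abs_continuous_on c d (\<lambda>t. \<phi> t + \<zeta> t)"
  unfolding abs_continuous_on_def
proof (intro allI impI)
  fix \<epsilon> :: real assume "\<epsilon> > 0"
  then have "\<epsilon> / 2 > 0" by simp
  obtain \<delta>1 where d1: "\<delta>1 > 0" and \<delta>1: "\<And>(n::nat) a b. \<lbrakk>\<forall>i<n. c \<le> a i \<and> a i \<le> b i \<and> b i \<le> d;
      disjoint_family_on (\<lambda>i. {a i<..<b i}) {..<n}; (\<Sum>i<n. b i - a i) < \<delta>1\<rbrakk> \<Longrightarrow>
      (\<Sum>i<n. norm (\<phi> (b i) - \<phi> (a i))) < \<epsilon> / 2"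
    by (rule abs_continuous_onE[OF assms(1) \<open>\<epsilon> / 2 > 0\<close>]) (rule that, assumption, blast)
  obtain \<delta>2 where d2: "\<delta>2 > 0" and \<delta>2: "\<And>(n::nat) a b. \<lbrakk>\<forall>i<n. c \<le> a i \<and> a i \<le> b i \<and> b i \<le> d;
      disjoint_family_on (\<lambda>i. {a i<..<b i}) {..<n}; (\<Sum>i<n. b i - a i) < \<delta>2\<rbrakk> \<Longrightarrow>
      (\<Sum>i<n. norm (\<zeta> (b i) - \<zeta> (a i))) < \<epsilon> / 2"
    by (rule abs_continuous_onE[OF assms(2) \<open>\<epsilon> / 2 > 0\<close>]) (rule that, assumption, blast)
  show "\<exists>\<delta>>0. \<forall>(n::nat) a b. (\<forall>i<n. c \<le> a i \<and> a i \<le> b i \<and> b i \<le> d) \<longrightarrow>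
      disjoint_family_on (\<lambda>i. {a i<..<b i}) {..<n} \<longrightarrow> (\<Sum>i<n. b i - a i) < \<delta> \<longrightarrow>
      (\<Sum>i<n. norm (\<phi> (b i) + \<zeta> (b i) - (\<phi> (a i) + \<zeta> (a i)))) < \<epsilon>"
  proof (intro exI[of _ "min \<delta>1 \<delta>2"] conjI allI impI)
    fix n :: nat and a b :: "nat \<Rightarrow> real"
    assume 1: "\<forall>i<n. c \<le> a i \<and> a i \<le> b i \<and> b i \<le> d"
      "disjoint_family_on (\<lambda>i. {a i<..<b i}) {..<n}" "(\<Sum>i<n. b i - a i) < min \<delta>1 \<delta>2"
    have "(\<Sum>i<n. norm (\<phi> (b i) + \<zeta> (b i) - (\<phi> (a i) + \<zeta> (a i))))
       \<le> (\<Sum>i<n. norm (\<phi> (b i) - \<phi> (a i)) + norm (\<zeta> (b i) - \<zeta> (a i)))"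
      by (intro sum_mono) (metis add_diff_add norm_triangle_ineq)
    also have "\<dots> < \<epsilon>"
      using \<delta>1[OF 1(1,2)] \<delta>2[OF 1(1,2)] 1(3) by (simp add: sum.distrib)
    finally show "(\<Sum>i<n. norm (\<phi> (b i) + \<zeta> (b i) - (\<phi> (a i) + \<zeta> (a i)))) < \<epsilon>" .
  qed (use d1 d2 in auto)
qed

lemma abs_continuous_on_lipschitz:
  assumes "\<And>s t. \<lbrakk>c \<le> s; s \<le> t; t \<le> d\<rbrakk> \<Longrightarrow> norm (\<phi> t - \<phi> s) \<le> L * (t - s)"
  shows "abs_continuous_on c d \<phi>"
  unfolding abs_continuous_on_def
proof (intro allI impI)
  fix \<epsilon> :: real assume "\<epsilon> > 0"
  show "\<exists>\<delta>>0. \<forall>(n::nat) a b. (\<forall>i<n. c \<le> a i \<and> a i \<le> b i \<and> b i \<le> d) \<longrightarrow>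
      disjoint_family_on (\<lambda>i. {a i<..<b i}) {..<n} \<longrightarrow> (\<Sum>i<n. b i - a i) < \<delta> \<longrightarrow>
      (\<Sum>i<n. norm (\<phi> (b i) - \<phi> (a i))) < \<epsilon>"
  proof (intro exI[of _ "\<epsilon> / (\<bar>L\<bar> + 1)"] conjI allI impI)
    fix n :: nat and a b :: "nat \<Rightarrow> real"
    assume 1: "\<forall>i<n. c \<le> a i \<and> a i \<le> b i \<and> b i \<le> d" "(\<Sum>i<n. b i - a i) < \<epsilon> / (\<bar>L\<bar> + 1)"
    have "(\<Sum>i<n. norm (\<phi> (b i) - \<phi> (a i))) \<le> (\<Sum>i<n. (\<bar>L\<bar> + 1) * (b i - a i))"
    proof (rule sum_mono)
      fix i assume "i \<in> {..<n}"
      then have "norm (\<phi> (b i) - \<phi> (a i)) \<le> L * (b i - a i)" "0 \<le> b i - a i" using assms 1 by auto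
      moreover have "L * (b i - a i) \<le> (\<bar>L\<bar> + 1) * (b i - a i)"
        using calculation(2) by (intro mult_right_mono) auto
      ultimately show "norm (\<phi> (b i) - \<phi> (a i)) \<le> (\<bar>L\<bar> + 1) * (b i - a i)" by linarith
    qed
    also have "\<dots> = (\<bar>L\<bar> + 1) * (\<Sum>i<n. b i - a i)" by (rule sum_distrib_left[symmetric])
    also have "\<dots> < (\<bar>L\<bar> + 1) * (\<epsilon> / (\<bar>L\<bar> + 1))"
      using 1(2) by (intro mult_strict_left_mono) auto
    also have "\<dots> = \<epsilon>" by auto
    finally show "(\<Sum>i<n. norm (\<phi> (b i) - \<phi> (a i))) < \<epsilon>" .
  qed (use \<open>\<epsilon> > 0\<close> in auto)
qed

text \<open>Truncation by \<open>min\<close> is monotone and contracting and maps each interval onto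
  a subinterval or collapses it, so a disjoint family stays disjoint and its total length does not
  grow. This freezes a path at time \<open>\<tau>\<close> before another piece is appended.\<close>

lemma abs_continuous_on_stopped:
  assumes "abs_continuous_on c d \<phi>" "c \<le> \<tau>"
  shows "abs_continuous_on c d (\<lambda>t. \<phi> (min t \<tau>))"
  unfolding abs_continuous_on_def
proof (intro allI impI)
  fix \<epsilon> :: real assume "\<epsilon> > 0"
  obtain \<delta> where "\<delta> > 0" and \<delta>: "\<And>(n::nat) a b. \<lbrakk>\<forall>i<n. c \<le> a i \<and> a i \<le> b i \<and> b i \<le> d;
      disjoint_family_on (\<lambda>i. {a i<..<b i}) {..<n}; (\<Sum>i<n. b i - a i) < \<delta>\<rbrakk> \<Longrightarrow>
      (\<Sum>i<n. norm (\<phi> (b i) - \<phi> (a i))) < \<epsilon>"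
    by (rule abs_continuous_onE[OF assms(1) \<open>\<epsilon> > 0\<close>]) (rule that, assumption, blast)
  show "\<exists>\<delta>>0. \<forall>(n::nat) a b. (\<forall>i<n. c \<le> a i \<and> a i \<le> b i \<and> b i \<le> d) \<longrightarrow>
      disjoint_family_on (\<lambda>i. {a i<..<b i}) {..<n} \<longrightarrow> (\<Sum>i<n. b i - a i) < \<delta> \<longrightarrow>
      (\<Sum>i<n. norm (\<phi> (min (b i) \<tau>) - \<phi> (min (a i) \<tau>))) < \<epsilon>"
  proof (intro exI[of _ \<delta>] conjI allI impI)
    fix n :: nat and a b :: "nat \<Rightarrow> real"
    assume 1: "\<forall>i<n. c \<le> a i \<and> a i \<le> b i \<and> b i \<le> d" 
      "disjoint_family_on (\<lambda>i. {a i<..<b i}) {..<n}" "(\<Sum>i<n. b i - a i) < \<delta>"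
    have "(\<Sum>i<n. min (b i) \<tau> - min (a i) \<tau>) \<le> (\<Sum>i<n. b i - a i)"
      using 1(1) by (intro sum_mono) (auto simp: min_def)
    then have 2: "(\<Sum>i<n. min (b i) \<tau> - min (a i) \<tau>) < \<delta>" using 1(3) by linarith
    have "{min (a i) \<tau><..<min (b i) \<tau>} \<subseteq> {a i<..<b i}" for i
      by (auto simp: min_def split: if_splits)
    then have 3: "disjoint_family_on (\<lambda>i. {min (a i) \<tau><..<min (b i) \<tau>}) {..<n}"
      using 1(2) unfolding disjoint_family_on_def by blast
    have 4: "\<forall>i<n. c \<le> min (a i) \<tau> \<and> min (a i) \<tau> \<le> min (b i) \<tau> \<and> min (b i) \<tau> \<le> d"
      using 1(1) assms(2) by (metis min.bounded_iff min.coboundedI1 min.mono order_refl order_trans)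
    show "(\<Sum>i<n. norm (\<phi> (min (b i) \<tau>) - \<phi> (min (a i) \<tau>))) < \<epsilon>"
      by (rule \<delta>[OF 4 3 2])
  qed (use \<open>\<delta> > 0\<close> in auto)
qed

section \<open>The value function\<close>

text \<open>For positive \<open>P\<close> and \<open>Q\<close> the smallest weighted mean is the
  geometric mean, attained at c = sqrt (Q / P). Bounds linear in \<open>P\<close> and
  \<open>Q\<close> can thus be integrated first and optimised afterwards, which yields the
  Cauchy-Schwarz inequality for path rewards.\<close>

lemma le_sqrt_mult_of_weighted_means:
  fixes X P Q :: real
  assumes "\<And>c. c > 0 \<Longrightarrow> X \<le> (c * P + Q / c) / 2" and "0 \<le> P" "0 \<le> Q"
  shows "X \<le> sqrt (P * Q)"
proof (cases "P = 0 \<or> Q = 0")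
  case False
  then have pos: "P > 0" "Q > 0" using assms by auto
  define c where "c = sqrt Q / sqrt P"
  have "c * P = sqrt Q * (P / sqrt P)" by (simp add: c_def)
  also have "P / sqrt P = sqrt P" using pos by (simp add: real_div_sqrt)
  finally have 1: "c * P = sqrt (P * Q)" by (simp add: real_sqrt_mult)
  have "Q / c = (Q / sqrt Q) * sqrt P" by (simp add: c_def)
  also have "Q / sqrt Q = sqrt Q" using pos by (simp add: real_div_sqrt)
  finally have 2: "Q / c = sqrt (P * Q)" by (simp add: real_sqrt_mult)
  have "c > 0" using pos by (simp add: c_def)
  then show ?thesis using assms(1)[of c] 1 2 by simp
next
  case True
  have "X \<le> 0"
  proof (rule ccontr)
    assume "\<not> X \<le> 0"
    then have X: "X > 0" by simp
    show False
    proof (cases "P = 0")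
      case True
      \<comment> \<open>For \<open>P = 0\<close> the optimal weight would be infinite; this finite
        one already gives \<open>X \<le> X / 2\<close>.\<close>
      have pos: "Q / X + 1 > 0" using X assms(3) by (simp add: add_nonneg_pos)
      have "X \<le> (Q / (Q / X + 1)) / 2" using assms(1)[OF pos] True by simp
      also have "\<dots> \<le> X / 2"
        using X assms(3) by (simp add: field_simps add_nonneg_pos)
      finally show False using X by simp
    next
      case False
      then have "Q = 0" using \<open>P = 0 \<or> Q = 0\<close> by simp
      then have "X \<le> X / 2" using assms(1)[of "X / P"] False X assms(2) by simp
      then show False using X by simp
    qed
  qed
  then show ?thesis using True by auto
qed

lemma sqrt_mult_le_weighted_mean:
  fixes p q c :: real
  assumes "0 \<le> p" "0 \<le> q" "c > 0"
  shows "sqrt (p * q) \<le> (c * p + q / c) / 2"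
  using arith_geo_mean_sqrt[of "c * p" "q / c"] assms by simp

text \<open>Working form of admissibility: the almost-everywhere condition becomes a negligible set,
  and the fundamental theorem for absolutely continuous paths, read in each component, turns
  derivatives into increments.\<close>

lemma admissible_pathE:
  assumes "\<phi> \<in> admissible_paths x"
  obtains S p q where "negligible S" "\<And>t. 0 \<le> p t" "\<And>t. 0 \<le> q t"
    "\<And>t. t \<in> {0..1} - S \<Longrightarrow> (\<phi> has_vector_derivative (p t, q t)) (at t)"
    "\<And>a b. \<lbrakk>0 \<le> a; a \<le> b; b \<le> 1\<rbrakk> \<Longrightarrow> (p has_integral fst (\<phi> b) - fst (\<phi> a)) {a..b}"
    "\<And>a b. \<lbrakk>0 \<le> a; a \<le> b; b \<le> 1\<rbrakk> \<Longrightarrow> (q has_integral snd (\<phi> b) - snd (\<phi> a)) {a..b}"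
proof -
  have ac: "abs_continuous_on 0 1 \<phi>" and ae: "AE s in lebesgue. s \<in> {0..1} \<longrightarrow>
        (\<exists>v. (\<phi> has_vector_derivative v) (at s) \<and> 0 \<le> fst v \<and> 0 \<le> snd v)"
    using assms by (auto simp: admissible_paths_def)
  obtain S where S: "negligible S" and S': "\<And>t. t \<in> {0..1} - S \<Longrightarrow>
      \<exists>v. (\<phi> has_vector_derivative v) (at t) \<and> 0 \<le> fst v \<and> 0 \<le> snd v"
  proof -
    obtain N where N: "N \<in> null_sets lebesgue" "{s \<in> space lebesgue. \<not> (s \<in> {0..1} \<longrightarrow>
        (\<exists>v. (\<phi> has_vector_derivative v) (at s) \<and> 0 \<le> fst v \<and> 0 \<le> snd v))} \<subseteq> N"
      using ae unfolding eventually_ae_filter by blast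
    show ?thesis
      by (rule that[of N]) (use N in \<open>auto simp: negligible_iff_null_sets simp del: split_paired_Ex\<close>)
  qed
  \<comment> \<open>The default 0 on the exceptional set makes both components nonnegative
    everywhere.\<close>
  define V where "V t = (if t \<in> {0..1} - S then vector_derivative \<phi> (at t) else 0)" for t
  have V: "(\<phi> has_vector_derivative V t) (at t)" if "t \<in> {0..1} - S" for t
    using S'[OF that] that vector_derivative_at unfolding V_def by force
  have V0: "0 \<le> fst (V t)" "0 \<le> snd (V t)" for t
  proof -
    have "0 \<le> fst (V t) \<and> 0 \<le> snd (V t)"
    proof (cases "t \<in> {0..1} - S")
      case True
      from S'[OF True] obtain v where v: "(\<phi> has_vector_derivative v) (at t)" "0 \<le> fst v" "0 \<le> snd v"
        by blast
      then show ?thesis using True vector_derivative_at[OF v(1)] by (simp add: V_def)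
    qed (auto simp: V_def)
    then show "0 \<le> fst (V t)" "0 \<le> snd (V t)" by auto
  qed
  have int: "(V has_integral \<phi> b - \<phi> a) {a..b}" if "0 \<le> a" "a \<le> b" "b \<le> 1" for a b
    by (rule abs_continuous_has_integral[OF ac that S]) (use V that in auto)
  show ?thesis
  proof (rule that[OF S V0])
    show "((\<lambda>t. fst (V t)) has_integral fst (\<phi> b) - fst (\<phi> a)) {a..b}"
      if "0 \<le> a" "a \<le> b" "b \<le> 1" for a b
      using has_integral_linear[OF int[OF that] bounded_linear_fst] by (simp add: o_def)
    show "((\<lambda>t. snd (V t)) has_integral snd (\<phi> b) - snd (\<phi> a)) {a..b}"
      if "0 \<le> a" "a \<le> b" "b \<le> 1" for a b
      using has_integral_linear[OF int[OF that] bounded_linear_snd] by (simp add: o_def)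
  qed (use V in auto)
qed

lemma admissible_path_mono:
  assumes "\<phi> \<in> admissible_paths x" "0 \<le> a" "a \<le> b" "b \<le> 1"
  shows "fst (\<phi> a) \<le> fst (\<phi> b)" "snd (\<phi> a) \<le> snd (\<phi> b)"
proof -
  obtain S p q where "\<And>t::real. 0 \<le> (p t::real)" "\<And>t::real. 0 \<le> (q t::real)"
    "(p has_integral fst (\<phi> b) - fst (\<phi> a)) {a..b}"
    "(q has_integral snd (\<phi> b) - snd (\<phi> a)) {a..b}"
    using admissible_pathE[OF assms(1)] assms(2-4) by metis
  then have "0 \<le> fst (\<phi> b) - fst (\<phi> a)" "0 \<le> snd (\<phi> b) - snd (\<phi> a)"
    by (meson has_integral_nonneg)+
  then show "fst (\<phi> a) \<le> fst (\<phi> b)" "snd (\<phi> a) \<le> snd (\<phi> b)" by auto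
qed

lemma admissible_path_endpoints:
  assumes "\<phi> \<in> admissible_paths x"
  shows "\<phi> 0 = 0" "\<phi> 1 = x"
  using assms by (auto simp: admissible_paths_def)

lemma admissible_path_continuous:
  assumes "\<phi> \<in> admissible_paths x"
  shows "continuous_on {0..1} \<phi>"
  using assms by (auto simp: admissible_paths_def intro: abs_continuous_on_imp_continuous_on)

lemma admissible_path_in_unit_square:
  assumes "\<phi> \<in> admissible_paths x" "x \<in> unit_square" "t \<in> {0..1}"
  shows "\<phi> t \<in> unit_square"
  using admissible_path_mono[OF assms(1), of 0 t] admissible_path_mono[OF assms(1), of t 1]
    admissible_path_endpoints[OF assms(1)] assms(2,3)
  by (auto simp: unit_square_def mem_Times_iff)

lemma linear_path_admissible:
  assumes "0 \<le> fst x" "0 \<le> snd x"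
  shows "(\<lambda>t. t *\<^sub>R x) \<in> admissible_paths x"
proof -
  have "abs_continuous_on 0 1 (\<lambda>t. t *\<^sub>R x)"
    by (rule abs_continuous_on_lipschitz[of _ _ _ "norm x"]) (simp flip: scaleR_diff_left)
  moreover have "((\<lambda>t. t *\<^sub>R x) has_vector_derivative x) (at s)" for s
    by (auto intro!: derivative_eq_intros)
  then have "\<exists>v. ((\<lambda>t. t *\<^sub>R x) has_vector_derivative v) (at s) \<and> 0 \<le> fst v \<and> 0 \<le> snd v" for s
    using assms by blast
  then have "AE s in lebesgue. s \<in> {0..1} \<longrightarrow>
      (\<exists>v. ((\<lambda>t. t *\<^sub>R x) has_vector_derivative v) (at s) \<and> 0 \<le> fst v \<and> 0 \<le> snd v)"
    by (intro AE_I2 impI)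
  ultimately show ?thesis by (simp add: admissible_paths_def del: split_paired_Ex)
qed

section \<open>Rewards along paths and elementary bounds on the value function\<close>

definition reward_rate :: "(real \<times> real \<Rightarrow> real) \<Rightarrow> (real \<Rightarrow> real \<times> real) \<Rightarrow> real \<Rightarrow> real" where
  "reward_rate f \<phi> t =
     f (\<phi> t) * sqrt (fst (vector_derivative \<phi> (at t)) * snd (vector_derivative \<phi> (at t)))"

locale running_reward =
  fixes f :: "real \<times> real \<Rightarrow> real"
  assumes f_cont: "continuous_on unit_square f"
    and f_nonneg: "x \<in> unit_square \<Longrightarrow> 0 \<le> f x"
begin

lemma f_bounded:
  obtains F where "F > 0" "\<And>x. x \<in> unit_square \<Longrightarrow> f x \<le> F"
proof -
  have "compact (f ` unit_square)"
    using f_cont by (intro compact_continuous_image) (auto simp: unit_square_def intro: compact_Times)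
  then obtain B where B: "\<And>y. y \<in> f ` unit_square \<Longrightarrow> norm y \<le> B"
    using compact_imp_bounded bounded_iff by metis
  show ?thesis
    by (rule that[of "\<bar>B\<bar> + 1"]) (use B in \<open>auto, fastforce\<close>)
qed

lemma f_uniformly_continuous:
  assumes "e > 0"
  obtains \<rho> where "\<rho> > 0" "\<And>x y. \<lbrakk>x \<in> unit_square; y \<in> unit_square; norm (x - y) < \<rho>\<rbrakk> \<Longrightarrow> \<bar>f x - f y\<bar> < e"
proof -
  have "uniformly_continuous_on unit_square f"
    using f_cont by (intro compact_uniformly_continuous) (auto simp: unit_square_def intro: compact_Times)
  then show ?thesis
    using assms that unfolding uniformly_continuous_on_def dist_norm by (metis real_norm_def)
qed

text \<open>The third claim is Cauchy-Schwarz: with a constant weight \<open>c\<close> the rate lies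
  below a linear combination of the two component derivatives, whose integrals are increments of the
  path, and optimising over \<open>c\<close> gives the square root. The reward of a piece is thus
  estimated by its displacement alone.\<close>

lemma reward_rate_integral:
  assumes \<phi>: "\<phi> \<in> admissible_paths x" and x: "x \<in> unit_square"
    and ab: "0 \<le> a" "a \<le> b" "b \<le> 1"
  shows "reward_rate f \<phi> absolutely_integrable_on {a..b}"
    and "0 \<le> integral {a..b} (reward_rate f \<phi>)"
    and "\<And>M. \<lbrakk>0 \<le> M; \<And>t. t \<in> {a..b} \<Longrightarrow> f (\<phi> t) \<le> M\<rbrakk> \<Longrightarrow> integral {a..b} (reward_rate f \<phi>)
      \<le> M * sqrt ((fst (\<phi> b) - fst (\<phi> a)) * (snd (\<phi> b) - snd (\<phi> a)))"
proof -
  obtain S p q where S: "negligible S" and p0: "\<And>t. 0 \<le> p t" and q0: "\<And>t. 0 \<le> q t"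
    and der: "\<And>t. t \<in> {0..1} - S \<Longrightarrow> (\<phi> has_vector_derivative (p t, q t)) (at t)"
    and p: "(p has_integral fst (\<phi> b) - fst (\<phi> a)) {a..b}"
    and q: "(q has_integral snd (\<phi> b) - snd (\<phi> a)) {a..b}"
    using admissible_pathE[OF \<phi>] ab by metis
  define r where "r t = f (\<phi> t) * sqrt (p t * q t)" for t
  have sq: "\<phi> t \<in> unit_square" if "t \<in> {a..b}" for t
    using admissible_path_in_unit_square[OF \<phi> x, of t] that ab by auto
  have r0: "0 \<le> r t" if "t \<in> {a..b}" for t
    using f_nonneg[OF sq[OF that]] p0[of t] q0[of t] by (simp add: r_def)
  have rr: "reward_rate f \<phi> t = r t" if "t \<in> {a..b} - S" for t
    using vector_derivative_at[OF der[of t]] that ab by (simp add: reward_rate_def r_def)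
  have rbound: "r t \<le> M * (c * p t + q t / c) / 2" if "0 \<le> M" "f (\<phi> t) \<le> M" "c > 0" for M t c
  proof -
    have "r t \<le> M * sqrt (p t * q t)"
      unfolding r_def using that p0[of t] q0[of t] by (intro mult_right_mono) auto
    also have "\<dots> \<le> M * ((c * p t + q t / c) / 2)"
      using that sqrt_mult_le_weighted_mean[OF p0 q0 that(3)] by (intro mult_left_mono) auto
    finally show ?thesis by simp
  qed
  have meas: "p \<in> borel_measurable (lebesgue_on {a..b})" "q \<in> borel_measurable (lebesgue_on {a..b})"
    using p q by (auto intro!: integrable_imp_measurable dest: has_integral_integrable)
  have "continuous_on {a..b} (\<lambda>t. f (\<phi> t))"
  proof (rule continuous_on_compose2[OF f_cont])
    show "continuous_on {a..b} \<phi>"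
      using admissible_path_continuous[OF \<phi>] ab by (auto intro: continuous_on_subset)
  qed (use sq in auto)
  then have "(\<lambda>t. f (\<phi> t)) \<in> borel_measurable (lebesgue_on {a..b})"
    by (intro continuous_imp_measurable_on_sets_lebesgue) auto
  then have rm: "r \<in> borel_measurable (lebesgue_on {a..b})"
    unfolding r_def using meas by measurable
  have rint: "r integrable_on {a..b}"
  proof -
    obtain F where F: "F > 0" "\<And>x. x \<in> unit_square \<Longrightarrow> f x \<le> F" by (rule f_bounded) blast
    have "((\<lambda>t. F * (1 * p t + q t / 1) / 2) has_integral
        F * (1 * (fst (\<phi> b) - fst (\<phi> a)) + (snd (\<phi> b) - snd (\<phi> a)) / 1) / 2) {a..b}"
      by (intro has_integral_mult_right has_integral_divide has_integral_add p q)
    then have "(\<lambda>t. F * (1 * p t + q t / 1) / 2) integrable_on {a..b}"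
      by (rule has_integral_integrable)
    then show ?thesis
    proof (rule measurable_bounded_by_integrable_imp_integrable_real[OF rm])
      fix t assume "t \<in> {a..b}"
      then show "\<bar>r t\<bar> \<le> F * (1 * p t + q t / 1) / 2"
        using rbound[of F t 1] F(1) F(2)[OF sq] r0[of t] by simp
    qed auto
  qed
  have rabs: "r absolutely_integrable_on {a..b}"
    by (rule nonnegative_absolutely_integrable_1[OF rint r0])
  show "reward_rate f \<phi> absolutely_integrable_on {a..b}"
    by (rule absolutely_integrable_spike[OF rabs S]) (use rr in auto)
  have eq: "integral {a..b} (reward_rate f \<phi>) = integral {a..b} r"
    by (rule integral_spike[OF S]) (use rr in auto)
  show "0 \<le> integral {a..b} (reward_rate f \<phi>)"
    unfolding eq by (rule integral_nonneg[OF rint r0])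
  fix M :: real assume M: "0 \<le> M" "\<And>t. t \<in> {a..b} \<Longrightarrow> f (\<phi> t) \<le> M"
  define P where "P = fst (\<phi> b) - fst (\<phi> a)"
  define Q where "Q = snd (\<phi> b) - snd (\<phi> a)"
  have PQ: "0 \<le> P" "0 \<le> Q"
    using admissible_path_mono[OF \<phi> ab] by (auto simp: P_def Q_def)
  have "integral {a..b} r \<le> sqrt ((M * P) * (M * Q))"
  proof (rule le_sqrt_mult_of_weighted_means)
    fix c :: real assume "c > 0"
    have "((\<lambda>t. M * (c * p t + q t / c) / 2) has_integral M * (c * P + Q / c) / 2) {a..b}"
      unfolding P_def Q_def
      by (intro has_integral_mult_right has_integral_divide has_integral_add p q)
    then have "integral {a..b} r \<le> M * (c * P + Q / c) / 2"
      using rbound[OF M(1) M(2) \<open>c > 0\<close>] rint integrable_integral has_integral_le by blast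
    then show "integral {a..b} r \<le> (c * (M * P) + (M * Q) / c) / 2"
      by (simp add: algebra_simps)
  qed (use M PQ in auto)
  also have "\<dots> = sqrt (M\<^sup>2 * (P * Q))" by (simp add: power2_eq_square algebra_simps)
  also have "\<dots> = M * sqrt (P * Q)" using M by (simp add: real_sqrt_mult)
  finally show "integral {a..b} (reward_rate f \<phi>)
      \<le> M * sqrt ((fst (\<phi> b) - fst (\<phi> a)) * (snd (\<phi> b) - snd (\<phi> a)))"
    unfolding eq P_def Q_def .
qed

lemma path_reward_eq_integral:
  assumes "\<phi> \<in> admissible_paths x" "x \<in> unit_square"
  shows "path_reward f \<phi> = integral {0..1} (reward_rate f \<phi>)"
  using set_lebesgue_integral_eq_integral(2)[OF reward_rate_integral(1)[OF assms, of 0 1]]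
  by (simp add: path_reward_def reward_rate_def[abs_def])

lemma path_reward_split:
  assumes "\<phi> \<in> admissible_paths x" "x \<in> unit_square" "0 \<le> \<tau>" "\<tau> \<le> 1"
  shows "path_reward f \<phi> = integral {0..\<tau>} (reward_rate f \<phi>) + integral {\<tau>..1} (reward_rate f \<phi>)"
  using Henstock_Kurzweil_Integration.integral_combine[of 0 \<tau> 1 "reward_rate f \<phi>"] assms
    reward_rate_integral(1)[OF assms(1,2), of 0 1]
  by (simp add: path_reward_eq_integral absolutely_integrable_on_def)

lemma path_reward_bounds:
  assumes "\<phi> \<in> admissible_paths x" "x \<in> unit_square" "0 \<le> F" "\<And>x. x \<in> unit_square \<Longrightarrow> f x \<le> F"
  shows "0 \<le> path_reward f \<phi>" "path_reward f \<phi> \<le> F * sqrt (fst x * snd x)"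
  using reward_rate_integral(2,3)[OF assms(1,2), of 0 1] assms(3)
    admissible_path_in_unit_square[OF assms(1,2)] assms(4)
  by (auto simp: path_reward_eq_integral[OF assms(1,2)] admissible_path_endpoints[OF assms(1)])

lemma admissible_paths_nonempty: "x \<in> unit_square \<Longrightarrow> admissible_paths x \<noteq> {}"
  using linear_path_admissible[of x] by (auto simp: unit_square_def)

lemma bdd_above_path_rewards:
  assumes "x \<in> unit_square"
  shows "bdd_above (path_reward f ` admissible_paths x)"
proof -
  obtain F where F: "F > 0" "\<And>x. x \<in> unit_square \<Longrightarrow> f x \<le> F" by (rule f_bounded) blast
  then show ?thesis
    using path_reward_bounds(2)[OF _ assms, of _ F] by (auto simp: bdd_above_def)
qed

lemma path_reward_le_value_fun:
  "\<lbrakk>\<phi> \<in> admissible_paths x; x \<in> unit_square\<rbrakk> \<Longrightarrow> path_reward f \<phi> \<le> value_fun f x"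
  unfolding value_fun_def by (rule cSUP_upper[OF _ bdd_above_path_rewards])

lemma value_fun_le:
  assumes "x \<in> unit_square" "0 \<le> F" "\<And>x. x \<in> unit_square \<Longrightarrow> f x \<le> F"
  shows "value_fun f x \<le> F * sqrt (fst x * snd x)"
  unfolding value_fun_def
  by (rule cSUP_least[OF admissible_paths_nonempty[OF assms(1)] path_reward_bounds(2)[OF _ assms]])

lemma value_fun_nonneg:
  assumes "x \<in> unit_square"
  shows "0 \<le> value_fun f x"
proof -
  obtain F where F: "F > 0" "\<And>x. x \<in> unit_square \<Longrightarrow> f x \<le> F" by (rule f_bounded) blast
  obtain \<phi> where "\<phi> \<in> admissible_paths x" using admissible_paths_nonempty[OF assms] by blast
  then show ?thesis
    using path_reward_bounds(1)[of \<phi> x F] path_reward_le_value_fun[of \<phi> x] F assms by force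
qed

lemma value_fun_almost_attained:
  assumes "x \<in> unit_square" "e > 0"
  obtains \<phi> where "\<phi> \<in> admissible_paths x" "value_fun f x < path_reward f \<phi> + e"
proof -
  have "value_fun f x - e < (SUP \<phi>\<in>admissible_paths x. path_reward f \<phi>)"
    using assms(2) by (simp add: value_fun_def)
  then obtain \<phi> where "\<phi> \<in> admissible_paths x" "value_fun f x - e < path_reward f \<phi>"
    using less_cSUP_iff[OF admissible_paths_nonempty[OF assms(1)] bdd_above_path_rewards[OF assms(1)]]
    by blast
  then show ?thesis using that by force
qed

section \<open>Dynamic programming inequalities for the value function\<close>

text \<open>Following a path up to time \<open>\<tau>\<close> and then a straight segment needs no reparametrisation.\<close>

lemma value_fun_ge_spliced:
  assumes \<phi>: "\<phi> \<in> admissible_paths y" and y: "y \<in> unit_square" and \<tau>: "0 \<le> \<tau>" "\<tau> < 1"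
    and z: "z \<in> unit_square" "fst (\<phi> \<tau>) \<le> fst z" "snd (\<phi> \<tau>) \<le> snd z"
    and c: "\<And>w. \<lbrakk>w \<in> unit_square; fst (\<phi> \<tau>) \<le> fst w; fst w \<le> fst z; snd (\<phi> \<tau>) \<le> snd w; snd w \<le> snd z\<rbrakk>
      \<Longrightarrow> c \<le> f w"
  shows "integral {0..\<tau>} (reward_rate f \<phi>)
      + c * sqrt ((fst z - fst (\<phi> \<tau>)) * (snd z - snd (\<phi> \<tau>))) \<le> value_fun f z"
proof -
  define v where "v = z - \<phi> \<tau>"
  have v0: "0 \<le> fst v" "0 \<le> snd v" using z by (auto simp: v_def)
  \<comment> \<open>\<open>min\<close> freezes the old path after \<open>\<tau>\<close>,
    \<open>max\<close> keeps the segment at rest before it. Both summands are absolutely continuous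
    on the whole interval, hence so is the sum.\<close>
  define \<zeta> where "\<zeta> t = \<phi> (min t \<tau>) + ((max t \<tau> - \<tau>) / (1 - \<tau>)) *\<^sub>R v" for t
  obtain S p q where S: "negligible S" and p0: "\<And>t. 0 \<le> p t" and q0: "\<And>t. 0 \<le> q t"
    and der: "\<And>t. t \<in> {0..1} - S \<Longrightarrow> (\<phi> has_vector_derivative (p t, q t)) (at t)"
    using admissible_pathE[OF \<phi>] by metis
  have der1: "(\<zeta> has_vector_derivative (p t, q t)) (at t)" if t: "t \<in> {0..<\<tau>} - S" for t
  proof (rule has_vector_derivative_transform_within_open[of _ _ _ "{..<\<tau>}"])
    show "(\<phi> has_vector_derivative (p t, q t)) (at t)" using der[of t] t \<tau> by auto
  qed (use t in \<open>auto simp: \<zeta>_def\<close>)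
  have der2: "(\<zeta> has_vector_derivative ((1 / (1 - \<tau>)) *\<^sub>R v)) (at t)" if t: "\<tau> < t" for t
  proof (rule has_vector_derivative_transform_within_open[of _ _ _ "{\<tau><..}"])
    show "((\<lambda>t. \<phi> \<tau> + ((t - \<tau>) / (1 - \<tau>)) *\<^sub>R v) has_vector_derivative ((1 / (1 - \<tau>)) *\<^sub>R v)) (at t)"
      using \<tau> by (auto intro!: derivative_eq_intros)
  qed (use t in \<open>auto simp: \<zeta>_def\<close>)
  have \<zeta>: "\<zeta> \<in> admissible_paths z"
  proof -
    have "abs_continuous_on 0 1 \<zeta>" unfolding \<zeta>_def
    proof (rule abs_continuous_on_add[OF abs_continuous_on_stopped])
      show "abs_continuous_on 0 1 (\<lambda>t. ((max t \<tau> - \<tau>) / (1 - \<tau>)) *\<^sub>R v)"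
      proof (rule abs_continuous_on_lipschitz)
        fix s t :: real assume st: "s \<le> t"
        have "norm (((max t \<tau> - \<tau>) / (1 - \<tau>)) *\<^sub>R v - ((max s \<tau> - \<tau>) / (1 - \<tau>)) *\<^sub>R v)
            = \<bar>max t \<tau> - max s \<tau>\<bar> / (1 - \<tau>) * norm v"
          using \<tau> by (simp flip: scaleR_diff_left diff_divide_distrib)
        also have "\<dots> \<le> (t - s) / (1 - \<tau>) * norm v"
          using st \<tau> by (intro mult_right_mono divide_right_mono) (auto simp: max_def)
        finally show "norm (((max t \<tau> - \<tau>) / (1 - \<tau>)) *\<^sub>R v - ((max s \<tau> - \<tau>) / (1 - \<tau>)) *\<^sub>R v)
            \<le> norm v / (1 - \<tau>) * (t - s)" by (simp add: algebra_simps)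
      qed
    qed (use \<phi> \<tau> in \<open>auto simp: admissible_paths_def\<close>)
    moreover have "\<zeta> 0 = 0" "\<zeta> 1 = z"
      using \<tau> admissible_path_endpoints[OF \<phi>] by (auto simp: \<zeta>_def v_def)
    moreover have "AE s in lebesgue. s \<in> {0..1} \<longrightarrow>
        (\<exists>v. (\<zeta> has_vector_derivative v) (at s) \<and> 0 \<le> fst v \<and> 0 \<le> snd v)"
    proof (rule AE_I')
      \<comment> \<open>At \<open>\<tau>\<close> the path may have a kink, so this time joins the
        exceptional set.\<close>
      show "insert \<tau> S \<in> null_sets lebesgue"
        using S by (simp flip: negligible_iff_null_sets)
      show "{s \<in> space lebesgue. \<not> (s \<in> {0..1} \<longrightarrow>
          (\<exists>v. (\<zeta> has_vector_derivative v) (at s) \<and> 0 \<le> fst v \<and> 0 \<le> snd v))} \<subseteq> insert \<tau> S"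
      proof (rule subsetI, rule ccontr)
        fix s assume s: "s \<in> {s \<in> space lebesgue. \<not> (s \<in> {0..1} \<longrightarrow>
          (\<exists>v. (\<zeta> has_vector_derivative v) (at s) \<and> 0 \<le> fst v \<and> 0 \<le> snd v))}" "s \<notin> insert \<tau> S"
        then have s': "s \<in> {0..1}" "s \<notin> S" "s \<noteq> \<tau>" 
          "\<And>v. (\<zeta> has_vector_derivative v) (at s) \<Longrightarrow> 0 \<le> fst v \<Longrightarrow> 0 \<le> snd v \<Longrightarrow> False"
          by (auto simp del: split_paired_All split_paired_Ex)
        show False
        proof (cases "s < \<tau>")
          case True
          then show False using s'(4)[OF der1] s' p0 q0 by auto
        next
          case False
          then show False using s'(4)[OF der2] s' v0 \<tau> by auto
        qed
      qed
    qed
    ultimately show ?thesis unfolding admissible_paths_def by blast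
  qed
  have 1: "integral {0..\<tau>} (reward_rate f \<zeta>) = integral {0..\<tau>} (reward_rate f \<phi>)"
  proof (rule integral_spike[of "insert \<tau> S"])
    fix t assume t: "t \<in> {0..\<tau>} - insert \<tau> S"
    then have t': "t \<in> {0..<\<tau>} - S" "t \<in> {0..1} - S" "\<zeta> t = \<phi> t" using \<tau> by (auto simp: \<zeta>_def)
    then show "reward_rate f \<phi> t = reward_rate f \<zeta> t"
      using vector_derivative_at[OF der] vector_derivative_at[OF der1] by (simp add: reward_rate_def)
  qed (use S in auto)
  \<comment> \<open>The segment has velocity v / (1 - \<tau>) and the square root is homogeneous of
    degree one, so integrating over time 1 - \<tau> leaves only the displacement.\<close>
  define k where "k = c * sqrt (fst v * snd v) / (1 - \<tau>)"
  have 2: "c * sqrt (fst v * snd v) \<le> integral {\<tau>..1} (reward_rate f \<zeta>)"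
  proof -
    have "c * sqrt (fst v * snd v) = integral {\<tau>..1} (\<lambda>t. k)"
      using \<tau> by (simp add: k_def)
    \<comment> \<open>The rate at \<open>\<tau>\<close> itself is unknown; altering the constant
      there makes the comparison hold at every point of the closed interval.\<close>
    also have "\<dots> = integral {\<tau>..1} (\<lambda>t. if t = \<tau> then reward_rate f \<zeta> \<tau> else k)"
      by (rule integral_spike[of "{\<tau>}"]) auto
    also have "\<dots> \<le> integral {\<tau>..1} (reward_rate f \<zeta>)"
    proof (rule integral_le)
      show "(\<lambda>t. if t = \<tau> then reward_rate f \<zeta> \<tau> else k) integrable_on {\<tau>..1}"
        by (rule integrable_spike[of "\<lambda>t. k" _ "{\<tau>}"]) auto
      show "reward_rate f \<zeta> integrable_on {\<tau>..1}"
        using reward_rate_integral(1)[OF \<zeta> z(1), of \<tau> 1] \<tau> by (simp add: absolutely_integrable_on_def)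
      fix t assume t: "t \<in> {\<tau>..1}"
      show "(if t = \<tau> then reward_rate f \<zeta> \<tau> else k) \<le> reward_rate f \<zeta> t"
      proof (cases "t = \<tau>")
        case False
        then have "\<tau> < t" using t by auto
        have "c \<le> f (\<zeta> t)"
        proof (rule c)
          show "\<zeta> t \<in> unit_square"
            using admissible_path_in_unit_square[OF \<zeta> z(1)] t \<tau> by auto
          have "\<zeta> \<tau> = \<phi> \<tau>" "\<zeta> 1 = z" using admissible_path_endpoints[OF \<zeta>] by (auto simp: \<zeta>_def)
          then show "fst (\<phi> \<tau>) \<le> fst (\<zeta> t)" "fst (\<zeta> t) \<le> fst z"
              "snd (\<phi> \<tau>) \<le> snd (\<zeta> t)" "snd (\<zeta> t) \<le> snd z"
            using admissible_path_mono[OF \<zeta>, of \<tau> t] admissible_path_mono[OF \<zeta>, of t 1] t \<tau> by auto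
        qed
        moreover have "sqrt (fst v * snd v) / (1 - \<tau>)
            = sqrt (fst ((1 / (1 - \<tau>)) *\<^sub>R v) * snd ((1 / (1 - \<tau>)) *\<^sub>R v))"
          using \<tau> by (simp add: real_sqrt_divide)
        ultimately have "c * (sqrt (fst v * snd v) / (1 - \<tau>)) \<le> reward_rate f \<zeta> t"
          unfolding reward_rate_def vector_derivative_at[OF der2[OF \<open>\<tau> < t\<close>]]
          using v0 \<tau> by (simp only:) (intro mult_right_mono, auto)
        then show ?thesis using False by (simp add: k_def)
      qed auto
    qed
    finally show ?thesis .
  qed
  have "integral {0..\<tau>} (reward_rate f \<phi>) + c * sqrt (fst v * snd v) \<le> path_reward f \<zeta>"
    using path_reward_split[OF \<zeta> z(1), of \<tau>] \<tau> 1 2 by linarith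
  also have "\<dots> \<le> value_fun f z" by (rule path_reward_le_value_fun[OF \<zeta> z(1)])
  finally show ?thesis by (simp add: v_def)
qed

text \<open>A nearly optimal path to \<open>y\<close> occupies the whole time interval, so it is cut
  shortly before time 1 and continued straight to \<open>z\<close>. The segment then starts slightly
  below \<open>y\<close>, which is why \<open>c\<close> must bound \<open>f\<close> on a box
  enlarged by \<open>\<rho>\<close>.\<close>

lemma value_fun_superadditive:
  assumes y: "y \<in> unit_square" and z: "z \<in> unit_square" "fst y \<le> fst z" "snd y \<le> snd z"
    and c: "0 \<le> c" "\<rho> > 0" "\<And>w. \<lbrakk>w \<in> unit_square; fst y - \<rho> \<le> fst w; fst w \<le> fst z;
        snd y - \<rho> \<le> snd w; snd w \<le> snd z\<rbrakk> \<Longrightarrow> c \<le> f w"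
  shows "value_fun f y + c * sqrt ((fst z - fst y) * (snd z - snd y)) \<le> value_fun f z"
proof (rule field_le_epsilon)
  fix e :: real assume "e > 0"
  then obtain \<phi> where \<phi>: "\<phi> \<in> admissible_paths y" "value_fun f y < path_reward f \<phi> + e / 2"
    using value_fun_almost_attained[OF y, of "e / 2"] by auto
  obtain F where F: "F > 0" "\<And>x. x \<in> unit_square \<Longrightarrow> f x \<le> F" by (rule f_bounded) blast
  \<comment> \<open>Keeps the segment inside the enlarged box and makes the reward of the discarded
    end at most \<open>F * \<eta> \<le> e / 2\<close>.\<close>
  define \<eta> where "\<eta> = min \<rho> (e / (2 * F))"
  have "\<eta> > 0" using \<open>e > 0\<close> c F by (simp add: \<eta>_def)
  note end\<phi> = admissible_path_endpoints[OF \<phi>(1)]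
  obtain d where "d > 0" and d: "\<And>t. t \<in> {0..1} \<Longrightarrow> dist t 1 < d \<Longrightarrow> dist (\<phi> t) (\<phi> 1) < \<eta>"
    using admissible_path_continuous[OF \<phi>(1), unfolded continuous_on_iff, rule_format, of 1 \<eta>] \<open>\<eta> > 0\<close>
    by auto
  define \<tau> where "\<tau> = max 0 (1 - d / 2)"
  have \<tau>: "0 \<le> \<tau>" "\<tau> < 1" "dist (\<phi> \<tau>) y < \<eta>"
    using d[of \<tau>] \<open>d > 0\<close> end\<phi> by (auto simp: \<tau>_def dist_norm)
  have D: "0 \<le> fst y - fst (\<phi> \<tau>)" "0 \<le> snd y - snd (\<phi> \<tau>)"
    using admissible_path_mono[OF \<phi>(1), of \<tau> 1] \<tau> end\<phi> by auto
  have D': "fst y - fst (\<phi> \<tau>) \<le> \<eta>" "snd y - snd (\<phi> \<tau>) \<le> \<eta>"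
    using dist_fst_le[of "\<phi> \<tau>" y] dist_snd_le[of "\<phi> \<tau>" y] \<tau>(3) by (auto simp: dist_real_def)
  have "integral {\<tau>..1} (reward_rate f \<phi>)
     \<le> F * sqrt ((fst (\<phi> 1) - fst (\<phi> \<tau>)) * (snd (\<phi> 1) - snd (\<phi> \<tau>)))"
    using \<tau> F admissible_path_in_unit_square[OF \<phi>(1) y] by (intro reward_rate_integral(3)[OF \<phi>(1) y]) auto
  also have "\<dots> \<le> F * sqrt (\<eta> * \<eta>)"
    using D D' F end\<phi> by (intro mult_left_mono real_sqrt_le_mono mult_mono) auto
  also have "\<dots> \<le> F * (e / (2 * F))"
    using \<open>\<eta> > 0\<close> F by (intro mult_left_mono) (auto simp: \<eta>_def)
  also have "\<dots> = e / 2" using F by simp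
  finally have "path_reward f \<phi> \<le> integral {0..\<tau>} (reward_rate f \<phi>) + e / 2"
    using path_reward_split[OF \<phi>(1) y, of \<tau>] \<tau> by linarith
  moreover have "integral {0..\<tau>} (reward_rate f \<phi>)
      + c * sqrt ((fst z - fst (\<phi> \<tau>)) * (snd z - snd (\<phi> \<tau>))) \<le> value_fun f z"
  proof (rule value_fun_ge_spliced[OF \<phi>(1) y \<tau>(1,2) z(1)])
    fix w assume "w \<in> unit_square" "fst (\<phi> \<tau>) \<le> fst w" "fst w \<le> fst z" "snd (\<phi> \<tau>) \<le> snd w" "snd w \<le> snd z"
    then show "c \<le> f w" using D' by (intro c(3)) (auto simp: \<eta>_def)
  qed (use D z in auto)
  \<comment> \<open>Starting the segment below \<open>y\<close> only enlarges both
    displacements.\<close>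
  moreover have "c * sqrt ((fst z - fst y) * (snd z - snd y))
      \<le> c * sqrt ((fst z - fst (\<phi> \<tau>)) * (snd z - snd (\<phi> \<tau>)))"
    using D z c by (intro mult_left_mono real_sqrt_le_mono mult_mono) auto
  ultimately show "value_fun f y + c * sqrt ((fst z - fst y) * (snd z - snd y)) \<le> value_fun f z + e"
    using \<phi>(2) by linarith
qed

lemma value_fun_mono:
  assumes "y \<in> unit_square" "z \<in> unit_square" "fst y \<le> fst z" "snd y \<le> snd z"
  shows "value_fun f y \<le> value_fun f z"
  using value_fun_superadditive[OF assms, of 0 1] f_nonneg by simp

text \<open>Along a nearly optimal path the intermediate value theorem finds a point at distance
  exactly \<open>t\<close> from \<open>y\<close>. Monotonicity keeps the rest of the path within
  that distance, where \<open>f\<close> is at most \<open>M\<close>, so Cauchy-Schwarz bounds its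
  reward by the displacement. The exact length of \<open>v\<close> lets later errors be compared
  with \<open>t\<close>.\<close>

lemma value_fun_last_step:
  assumes y: "y \<in> unit_square" and t: "0 < t" "t \<le> norm y" and "\<eta> > 0"
    and M: "0 \<le> M" "\<And>w. \<lbrakk>w \<in> unit_square; norm (w - y) \<le> t\<rbrakk> \<Longrightarrow> f w \<le> M"
  obtains v where "0 \<le> fst v" "0 \<le> snd v" "norm v = t" "y - v \<in> unit_square"
    "value_fun f y \<le> value_fun f (y - v) + M * sqrt (fst v * snd v) + \<eta>"
proof -
  obtain \<phi> where \<phi>: "\<phi> \<in> admissible_paths y" "value_fun f y < path_reward f \<phi> + \<eta>"
    using value_fun_almost_attained[OF y \<open>\<eta> > 0\<close>] by blast
  note end\<phi> = admissible_path_endpoints[OF \<phi>(1)]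
  have "\<exists>\<tau>\<ge>0. \<tau> \<le> 1 \<and> norm (y - \<phi> \<tau>) = t"
    using admissible_path_continuous[OF \<phi>(1)] t end\<phi>
    by (intro IVT2') (auto intro!: continuous_intros)
  then obtain \<tau> where \<tau>: "0 \<le> \<tau>" "\<tau> \<le> 1" "norm (y - \<phi> \<tau>) = t" by blast
  have "\<tau> \<noteq> 1" using \<tau>(3) end\<phi> t by auto
  then have "\<tau> < 1" using \<tau> by simp
  define v where "v = y - \<phi> \<tau>"
  have v0: "0 \<le> fst v" "0 \<le> snd v"
    using admissible_path_mono[OF \<phi>(1), of \<tau> 1] \<tau> end\<phi> by (auto simp: v_def)
  have sq: "\<phi> s \<in> unit_square" if "s \<in> {0..1}" for s
    using admissible_path_in_unit_square[OF \<phi>(1) y that] .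
  have "integral {\<tau>..1} (reward_rate f \<phi>)
     \<le> M * sqrt ((fst (\<phi> 1) - fst (\<phi> \<tau>)) * (snd (\<phi> 1) - snd (\<phi> \<tau>)))"
  proof (rule reward_rate_integral(3)[OF \<phi>(1) y \<tau>(1,2) order_refl M(1)])
    fix s assume s: "s \<in> {\<tau>..1}"
    show "f (\<phi> s) \<le> M"
    proof (rule M(2)[OF sq])
      have "\<bar>fst (\<phi> s - y)\<bar> \<le> \<bar>fst v\<bar>" "\<bar>snd (\<phi> s - y)\<bar> \<le> \<bar>snd v\<bar>"
        using admissible_path_mono[OF \<phi>(1), of \<tau> s] admissible_path_mono[OF \<phi>(1), of s 1] s \<tau> end\<phi>
        by (auto simp: v_def)
      then have "(fst (\<phi> s - y))\<^sup>2 + (snd (\<phi> s - y))\<^sup>2 \<le> (fst v)\<^sup>2 + (snd v)\<^sup>2"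
        by (intro add_mono) (simp_all only: abs_le_square_iff)
      then have "norm (\<phi> s - y) \<le> norm v" by (simp add: norm_prod_def)
      then show "norm (\<phi> s - y) \<le> t" using \<tau>(3) by (simp add: v_def)
    qed (use s \<tau> in auto)
  qed
  \<comment> \<open>Splicing with a segment of length zero: the path stopped at
    \<open>\<tau>\<close> competes for the value at \<open>\<phi> \<tau>\<close>.\<close>
  moreover have "integral {0..\<tau>} (reward_rate f \<phi>) \<le> value_fun f (\<phi> \<tau>)"
    using value_fun_ge_spliced[OF \<phi>(1) y \<tau>(1) \<open>\<tau> < 1\<close> sq, of \<tau> 0] \<tau> f_nonneg by simp
  ultimately have "value_fun f y \<le> value_fun f (y - v) + M * sqrt (fst v * snd v) + \<eta>"
    using \<phi>(2) path_reward_split[OF \<phi>(1) y \<tau>(1,2)] end\<phi> by (simp add: v_def)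
  then show ?thesis
    using that[OF v0] \<tau> sq[of \<tau>] by (simp add: v_def)
qed

end

section \<open>Monotonicity and consistency of the scheme\<close>

text \<open>The test functions in the scheme variable. Additive constants are left out because they
  enter as the shift \<open>\<xi>\<close>, over which \<open>cond_G4\<close> is uniform as long as
  it is bounded by \<open>L\<close>.\<close>

definition quad :: "real \<Rightarrow> real \<Rightarrow> real \<Rightarrow> real \<times> real \<Rightarrow> real" where
  "quad K p q x = K * ((fst x)\<^sup>2 + (snd x)\<^sup>2) + p * fst x + q * snd x"

text \<open>The gradient of \<open>quad\<close> paired with \<open>\<alpha>\<close>, the first-order
  loss in a step back along \<open>\<alpha>\<close>.\<close>

definition quad_slope :: "real \<Rightarrow> real \<Rightarrow> real \<Rightarrow> real \<times> real \<Rightarrow> real \<times> real \<Rightarrow> real" where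
  "quad_slope K p q x \<alpha> = (2 * K * fst x + p) * fst \<alpha> + (2 * K * snd x + q) * snd \<alpha>"

lemma quad_shift:
  "quad K p q (x - h *\<^sub>R \<alpha>) = quad K p q x - h * quad_slope K p q x \<alpha> + K * h\<^sup>2 * ((fst \<alpha>)\<^sup>2 + (snd \<alpha>)\<^sup>2)"
  by (simp add: quad_def quad_slope_def power2_eq_square algebra_simps)

lemma C_diff_affine: "C_diff k (\<lambda>x. p * fst x + q * snd x + c)"
proof (induction k arbitrary: p q c)
  case 0
  then show ?case by (auto intro!: continuous_intros)
next
  case (Suc k)
  have "((\<lambda>x. p * fst x + q * snd x + c) has_derivative (\<lambda>v. p * fst v + q * snd v)) (at x)" for x
    by (auto intro!: derivative_eq_intros)
  moreover have "C_diff k (\<lambda>_. p)" "C_diff k (\<lambda>_. q)"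
    using Suc[of 0 0 p] Suc[of 0 0 q] by simp_all
  ultimately show ?case
    unfolding C_diff.simps by (intro exI[of _ "\<lambda>_. p"] exI[of _ "\<lambda>_. q"]) blast
qed

lemma smooth_quad: "smooth (quad K p q)"
  unfolding smooth_def
proof
  fix k
  show "C_diff k (quad K p q)"
  proof (cases k)
    case 0
    then show ?thesis by (auto simp: quad_def[abs_def] intro!: continuous_intros)
  next
    case (Suc j)
    \<comment> \<open>The zero coefficients give the partial derivatives the shape of
      \<open>C_diff_affine\<close>.\<close>
    define P where "P = (\<lambda>x :: real \<times> real. 2 * K * fst x + 0 * snd x + p)"
    define Q where "Q = (\<lambda>x :: real \<times> real. 0 * fst x + 2 * K * snd x + q)"
    have "(quad K p q has_derivative (\<lambda>v. P x * fst v + Q x * snd v)) (at x)" for x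
      unfolding quad_def[abs_def] P_def Q_def by (auto intro!: derivative_eq_intros simp: algebra_simps)
    moreover have "C_diff j P" "C_diff j Q" unfolding P_def Q_def by (rule C_diff_affine)+
    ultimately show ?thesis unfolding Suc C_diff.simps by blast
  qed
qed

section \<open>Grids and directed rounding\<close>

lemma mesh_pos: "N \<ge> 1 \<Longrightarrow> 0 < mesh N"
  by (simp add: mesh_def)

lemma mesh_tendsto_0: "mesh \<longlonglongrightarrow> 0"
  unfolding mesh_def[abs_def] by (rule lim_1_over_n)

lemma eventually_mesh_less:
  assumes "0 < e"
  shows "\<forall>\<^sub>F N in sequentially. mesh N < e"
  using order_tendstoD(2)[OF mesh_tendsto_0 assms] .

lemma finite_grid: "finite (grid N)"
proof -
  have "grid N = (\<lambda>(i, j). (real i * mesh N, real j * mesh N)) ` ({..N} \<times> {..N})"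
    by (auto simp: grid_def)
  then show ?thesis by simp
qed

lemma grid_subset_unit_square: "grid N \<subseteq> unit_square"
proof
  \<comment> \<open>For \<open>N = 0\<close> division by zero makes \<open>mesh 0 = 0\<close>, so
    the grid is the origin alone.\<close>
  have *: "0 \<le> real i * mesh N \<and> real i * mesh N \<le> 1" if "i \<le> N" for i
    using that by (cases "N = 0") (auto simp: mesh_def field_simps)
  fix x assume "x \<in> grid N"
  then show "x \<in> unit_square" using * by (auto simp: grid_def unit_square_def)
qed

lemma grid_nonempty: "grid N \<noteq> {}"
  by (auto simp: grid_def)

lemma inner_grid_iff: "x \<in> inner_grid N \<longleftrightarrow> x \<in> grid N \<and> fst x \<noteq> 0 \<and> snd x \<noteq> 0"
  using grid_subset_unit_square[of N] by (force simp: inner_grid_def unit_square_def mem_Times_iff)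

text \<open>Rounding towards the origin, so that by monotonicity it cannot raise the value
  function.\<close>

lemma unit_square_floor_grid:
  assumes "y \<in> unit_square" "n \<ge> 1"
  obtains z where "z \<in> grid n" "fst z \<le> fst y" "snd z \<le> snd y"
    "\<bar>fst y - fst z\<bar> \<le> mesh n" "\<bar>snd y - snd z\<bar> \<le> mesh n"
proof -
  have *: "\<exists>i\<le>n. real i * mesh n \<le> s \<and> \<bar>s - real i * mesh n\<bar> \<le> mesh n" if "0 \<le> s" "s \<le> 1" for s
  proof -
    define i where "i = nat \<lfloor>s * real n\<rfloor>"
    have "real i \<le> s * real n" "s * real n \<le> real i + 1" using that by (auto simp: i_def)
    moreover have "s * real n \<le> real n" using that by (simp add: mult_left_le_one_le)
    ultimately have "i \<le> n" by linarith
    moreover have "real i / real n \<le> s" "s \<le> (real i + 1) / real n"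
      using \<open>real i \<le> s * real n\<close> \<open>s * real n \<le> real i + 1\<close> assms(2) by (simp_all add: divide_le_eq le_divide_eq)
    ultimately show ?thesis by (intro exI[of _ i]) (simp add: mesh_def add_divide_distrib)
  qed
  obtain i j where "i \<le> n" "real i * mesh n \<le> fst y" "\<bar>fst y - real i * mesh n\<bar> \<le> mesh n"
    "j \<le> n" "real j * mesh n \<le> snd y" "\<bar>snd y - real j * mesh n\<bar> \<le> mesh n"
    using *[of "fst y"] *[of "snd y"] assms(1) by (auto simp: unit_square_def mem_Times_iff)
  then show ?thesis by (intro that[of "(real i * mesh n, real j * mesh n)"]) (auto simp: grid_def)
qed

text \<open>Rounding away from the origin, for the inequality in which the value function must not
  drop. The result stays in the square because 1 is a grid coordinate.\<close>

lemma unit_square_ceiling_grid: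
  assumes "y \<in> unit_square" "n \<ge> 1"
  obtains z where "z \<in> grid n" "fst y \<le> fst z" "snd y \<le> snd z"
    "\<bar>fst y - fst z\<bar> \<le> mesh n" "\<bar>snd y - snd z\<bar> \<le> mesh n"
proof -
  have *: "\<exists>i\<le>n. s \<le> real i * mesh n \<and> \<bar>s - real i * mesh n\<bar> \<le> mesh n" if "0 \<le> s" "s \<le> 1" for s
  proof -
    define i where "i = nat \<lceil>s * real n\<rceil>"
    have "0 \<le> s * real n" using that by simp
    then have "s * real n \<le> real i" "real i \<le> s * real n + 1"
      using of_int_ceiling_le_add_one[of "s * real n"] by (auto simp: i_def)
    moreover have "s * real n \<le> real n" using that by (simp add: mult_left_le_one_le)
    moreover have "i \<le> n" using \<open>s * real n \<le> real n\<close> by (simp add: i_def ceiling_le_iff nat_le_iff)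
    moreover have "s \<le> real i / real n" "real i / real n \<le> s + 1 / real n"
    proof -
      show "s \<le> real i / real n" using \<open>s * real n \<le> real i\<close> assms(2) by (simp add: le_divide_eq)
      have "real i / real n \<le> (s * real n + 1) / real n"
        using \<open>real i \<le> s * real n + 1\<close> by (rule divide_right_mono) simp
      then show "real i / real n \<le> s + 1 / real n" using assms(2) by (simp add: add_divide_distrib)
    qed
    ultimately show ?thesis by (intro exI[of _ i]) (simp add: mesh_def)
  qed
  obtain i j where "i \<le> n" "fst y \<le> real i * mesh n" "\<bar>fst y - real i * mesh n\<bar> \<le> mesh n"
    "j \<le> n" "snd y \<le> real j * mesh n" "\<bar>snd y - real j * mesh n\<bar> \<le> mesh n"
    using *[of "fst y"] *[of "snd y"] assms(1) by (auto simp: unit_square_def mem_Times_iff)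
  then show ?thesis by (intro that[of "(real i * mesh n, real j * mesh n)"]) (auto simp: grid_def)
qed

lemma norm_le_fst_plus_snd: "\<lbrakk>0 \<le> fst v; 0 \<le> snd v\<rbrakk> \<Longrightarrow> norm (v :: real \<times> real) \<le> fst v + snd v"
  unfolding norm_prod_def by (simp add: sqrt_sum_squares_le_sum)

lemma sqrt_mult_le_norm:
  assumes "0 \<le> fst v" "0 \<le> snd v"
  shows "sqrt (fst v * snd v) \<le> norm (v :: real \<times> real)"
proof -
  have "fst v * snd v \<le> (fst v)\<^sup>2 + (snd v)\<^sup>2"
    using sum_squares_bound[of "fst v" "snd v"] assms by (auto intro: order_trans[rotated])
  then show ?thesis unfolding norm_prod_def by simp
qed

text \<open>With W = U - a the claim is a^2 + b^2 \<le> (W - h \<kappa> / 4)^2. Relaxing the gap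
  from h \<kappa> / 2 to h \<kappa> / 4 gains about h \<kappa> W / 2 in the square, which is of
  order h because W \<ge> \<epsilon> - h G, whereas a^2 \<le> (h G)^2 is of order h^2. The
  hypothesis \<open>small\<close> says that the gain wins.\<close>

lemma scheme_step_less:
  fixes h \<kappa> a b U G \<epsilon> :: real
  assumes "0 < h" "0 < \<kappa>" "0 \<le> a" "a \<le> h * G" "0 \<le> b" "b \<le> U - a - h * \<kappa> / 2" "\<epsilon> \<le> U"
    and small: "h * (G\<^sup>2 + \<kappa> / 4 * (2 * G + \<kappa>)) \<le> \<kappa> / 2 * \<epsilon>"
  shows "a + sqrt (a\<^sup>2 + b\<^sup>2) \<le> U - h * \<kappa> / 4"
proof -
  define W where "W = U - a"
  have "0 < h * \<kappa>" using assms by simp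
  have W: "b \<le> W - h * \<kappa> / 2" "\<epsilon> - h * G \<le> W" using assms by (auto simp: W_def)
  have "b\<^sup>2 \<le> (W - h * \<kappa> / 2)\<^sup>2" using W assms by (intro power_mono) auto
  moreover have "a\<^sup>2 \<le> (h * G)\<^sup>2" using assms by (intro power_mono) auto
  moreover have "(h * G)\<^sup>2 \<le> h * \<kappa> / 4 * (2 * W - 3 * h * \<kappa> / 4)"
  proof -
    have "h * (G\<^sup>2 + \<kappa> / 4 * (2 * G + 3 * \<kappa> / 4)) \<le> h * (G\<^sup>2 + \<kappa> / 4 * (2 * G + \<kappa>))"
      using assms by (intro mult_left_mono add_left_mono) auto
    also have "\<dots> \<le> \<kappa> / 2 * \<epsilon>" by (rule small)
    also have "\<dots> \<le> \<kappa> / 2 * (W + h * G)" using W assms by (intro mult_left_mono) auto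
    finally have "h * (G\<^sup>2) \<le> \<kappa> / 4 * (2 * W - 3 * h * \<kappa> / 4)" by (simp add: algebra_simps)
    then have "h * (h * G\<^sup>2) \<le> h * (\<kappa> / 4 * (2 * W - 3 * h * \<kappa> / 4))"
      using assms by (intro mult_left_mono) auto
    then show ?thesis by (simp add: power2_eq_square algebra_simps)
  qed
  ultimately have "a\<^sup>2 + b\<^sup>2 \<le> (W - h * \<kappa> / 4)\<^sup>2"
    by (simp add: power2_eq_square algebra_simps)
  moreover have "0 \<le> W - h * \<kappa> / 4" using W assms \<open>0 < h * \<kappa>\<close> by linarith
  ultimately have "sqrt (a\<^sup>2 + b\<^sup>2) \<le> W - h * \<kappa> / 4" by (rule real_le_lsqrt[rotated])
  then show ?thesis by (simp add: W_def)
qed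

section \<open>The scheme operator, its fixed points and its consistency\<close>

locale scheme = running_reward f for f +
  fixes A :: "(real \<times> real) set" and g :: approximations
  assumes A1: "cond_A1 A" and A2: "cond_A2 A"
    and G1: "cond_G1 A g" and G3: "cond_G3 A g" and G4: "cond_G4 A g"
begin

definition scheme_term :: "nat \<Rightarrow> real \<times> real \<Rightarrow> (real \<times> real \<Rightarrow> real) \<Rightarrow> real \<times> real \<Rightarrow> real" where
  "scheme_term N x v \<alpha> = mesh N * f x * sqrt (fst \<alpha> * snd \<alpha>)
     + sqrt ((mesh N)\<^sup>2 * (f x)\<^sup>2 * fst \<alpha> * snd \<alpha> + (g N x \<alpha> v)\<^sup>2)"

lemma A_nonneg: "\<alpha> \<in> A \<Longrightarrow> 0 \<le> fst \<alpha>" "\<alpha> \<in> A \<Longrightarrow> 0 \<le> snd \<alpha>"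
  using A1 by (auto simp: cond_A1_def quadrant_def)

lemma A_nonempty: "A \<noteq> {}"
  using A1 by (auto simp: cond_A1_def quadrant_def)

lemma A_bounded_below:
  obtains r where "r > 0" "\<And>\<alpha>. \<alpha> \<in> A \<Longrightarrow> r \<le> norm \<alpha>"
proof (rule that[of "INF \<alpha>\<in>A. norm \<alpha>"])
  show "(INF \<alpha>\<in>A. norm \<alpha>) \<le> norm \<alpha>" if "\<alpha> \<in> A" for \<alpha>
    by (rule cINF_lower[OF _ that]) (auto intro: bdd_belowI[of _ 0])
qed (use A1 in \<open>simp add: cond_A1_def\<close>)

lemma A_bounded_above:
  obtains R where "R > 0" "\<And>\<alpha>. \<alpha> \<in> A \<Longrightarrow> norm \<alpha> \<le> R"
proof -
  obtain B where "\<And>\<alpha>. \<alpha> \<in> A \<Longrightarrow> norm \<alpha> \<le> B"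
    using A2 compact_imp_bounded bounded_iff unfolding cond_A2_def by metis
  then show ?thesis by (intro that[of "\<bar>B\<bar> + 1"]) (auto, force)
qed

lemma inner_grid_in_grid: "x \<in> inner_grid N \<Longrightarrow> x \<in> grid N"
  by (simp add: inner_grid_def)

lemma inner_grid_in_unit_square: "x \<in> inner_grid N \<Longrightarrow> x \<in> unit_square"
  using grid_subset_unit_square inner_grid_in_grid by blast

lemma g_mono:
  "\<lbrakk>N \<ge> 1; x \<in> grid N; \<alpha> \<in> A; \<And>y. y \<in> grid N \<Longrightarrow> v y \<le> w y\<rbrakk> \<Longrightarrow> g N x \<alpha> v \<le> g N x \<alpha> w"
  using G1 unfolding cond_G1_def by blast

lemma g_const: "\<lbrakk>N \<ge> 1; x \<in> grid N; \<alpha> \<in> A\<rbrakk> \<Longrightarrow> g N x \<alpha> (\<lambda>_. c) = c"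
  using G3 unfolding cond_G3_def by blast

lemma g_ge_const:
  "\<lbrakk>N \<ge> 1; x \<in> grid N; \<alpha> \<in> A; \<And>y. y \<in> grid N \<Longrightarrow> c \<le> v y\<rbrakk> \<Longrightarrow> c \<le> g N x \<alpha> v"
  using g_mono[of N x \<alpha> "\<lambda>_. c" v] g_const[of N x \<alpha> c] by simp

lemma g_le_const:
  "\<lbrakk>N \<ge> 1; x \<in> grid N; \<alpha> \<in> A; \<And>y. y \<in> grid N \<Longrightarrow> v y \<le> c\<rbrakk> \<Longrightarrow> g N x \<alpha> v \<le> c"
  using g_mono[of N x \<alpha> v "\<lambda>_. c"] g_const[of N x \<alpha> c] by simp

text \<open>The same quantity a occurs outside and inside the root, so t = a + sqrt (a^2 + b^2)
  solves t^2 - 2 a t = b^2: the discrete trace of replacing Du by D(u^2) / (2u).\<close>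

lemma scheme_term_eq:
  assumes "\<alpha> \<in> A"
  shows "scheme_term N x v \<alpha> = mesh N * f x * sqrt (fst \<alpha> * snd \<alpha>)
    + sqrt ((mesh N * f x * sqrt (fst \<alpha> * snd \<alpha>))\<^sup>2 + (g N x \<alpha> v)\<^sup>2)"
  using A_nonneg[OF assms] by (simp add: scheme_term_def power_mult_distrib algebra_simps)

lemma scheme_term_nonneg:
  assumes "\<alpha> \<in> A" "x \<in> inner_grid N"
  shows "0 \<le> scheme_term N x v \<alpha>"
  unfolding scheme_term_eq[OF assms(1)]
  using A_nonneg[OF assms(1)] f_nonneg[OF inner_grid_in_unit_square[OF assms(2)]]
  by (simp add: mesh_def)

text \<open>Only the square of \<open>g N x \<alpha> v\<close> enters, so the smaller function has
  to be nonnegative; \<open>g_ge_const\<close> passes this on to \<open>g\<close>.\<close>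

lemma scheme_term_mono:
  assumes "N \<ge> 1" "\<alpha> \<in> A" "x \<in> inner_grid N" "\<And>y. y \<in> grid N \<Longrightarrow> 0 \<le> v y" "\<And>y. y \<in> grid N \<Longrightarrow> v y \<le> w y"
  shows "scheme_term N x v \<alpha> \<le> scheme_term N x w \<alpha>"
proof -
  have "0 \<le> g N x \<alpha> v" "g N x \<alpha> v \<le> g N x \<alpha> w"
    using assms by (auto intro!: g_ge_const g_mono inner_grid_in_grid)
  then have "(g N x \<alpha> v)\<^sup>2 \<le> (g N x \<alpha> w)\<^sup>2" by (intro power_mono)
  then show ?thesis by (simp add: scheme_term_eq[OF assms(2)])
qed

text \<open>Monotonicity and exactness on constants confine \<open>g\<close> to the interval from
  \<open>- B\<close> to \<open>B\<close>, however it depends on \<open>\<alpha>\<close>, so the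
  supremum over \<open>A\<close> is a genuine one.\<close>

lemma bdd_above_scheme_term:
  assumes "N \<ge> 1" "x \<in> inner_grid N"
  shows "bdd_above (scheme_term N x v ` A)"
proof -
  obtain R where R: "R > 0" "\<And>\<alpha>. \<alpha> \<in> A \<Longrightarrow> norm \<alpha> \<le> R" by (rule A_bounded_above) blast
  define B where "B = Max ((\<lambda>y. \<bar>v y\<bar>) ` grid N)"
  have B: "\<bar>v y\<bar> \<le> B" if "y \<in> grid N" for y
    unfolding B_def using that finite_grid by (intro Max_ge) auto
  have f0: "0 \<le> mesh N * f x"
    using f_nonneg[OF inner_grid_in_unit_square[OF assms(2)]] by (simp add: mesh_def)
  have "scheme_term N x v \<alpha> \<le> mesh N * f x * R + sqrt ((mesh N * f x * R)\<^sup>2 + B\<^sup>2)" if "\<alpha> \<in> A" for \<alpha>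
  proof -
    have "sqrt (fst \<alpha> * snd \<alpha>) \<le> R"
      using sqrt_mult_le_norm[of \<alpha>] A_nonneg[OF that] R(2)[OF that] by linarith
    then have 1: "mesh N * f x * sqrt (fst \<alpha> * snd \<alpha>) \<le> mesh N * f x * R"
      by (rule mult_left_mono[OF _ f0])
    have "- B \<le> g N x \<alpha> v" "g N x \<alpha> v \<le> B"
      using B that assms by (auto intro!: g_ge_const g_le_const inner_grid_in_grid simp: abs_le_iff minus_le_iff)
    then have "(g N x \<alpha> v)\<^sup>2 \<le> B\<^sup>2" by (simp add: abs_le_iff abs_le_square_iff[symmetric])
    moreover have "(mesh N * f x * sqrt (fst \<alpha> * snd \<alpha>))\<^sup>2 \<le> (mesh N * f x * R)\<^sup>2"
      using 1 f0 A_nonneg[OF that] by (intro power_mono) auto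
    ultimately show ?thesis
      unfolding scheme_term_eq[OF that] using 1 by (intro add_mono real_sqrt_le_mono) auto
  qed
  then show ?thesis by (rule bdd_aboveI2)
qed

lemma scheme_solution_iff:
  "scheme_solution f A g N v \<longleftrightarrow>
    (\<forall>x\<in>inner_grid N. v x = (SUP \<alpha>\<in>A. scheme_term N x v \<alpha>)) \<and>
    (\<forall>x\<in>grid N. x \<notin> inner_grid N \<longrightarrow> v x = 0)"
  unfolding scheme_solution_def scheme_term_def using inner_grid_iff by auto

lemma scheme_solution_ge_term:
  assumes "N \<ge> 1" "scheme_solution f A g N v" "x \<in> inner_grid N" "\<alpha> \<in> A"
  shows "scheme_term N x v \<alpha> \<le> v x"
  using assms cSUP_upper[OF assms(4) bdd_above_scheme_term[OF assms(1,3)]]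
  by (simp add: scheme_solution_iff)

lemma scheme_solution_nonneg:
  assumes "N \<ge> 1" "scheme_solution f A g N v" "x \<in> grid N"
  shows "0 \<le> v x"
proof (cases "x \<in> inner_grid N")
  case True
  obtain \<alpha> where "\<alpha> \<in> A" using A_nonempty by blast
  then show ?thesis
    using scheme_solution_ge_term[OF assms(1,2) True] scheme_term_nonneg[OF _ True] by (meson order_trans)
qed (use assms in \<open>simp add: scheme_solution_iff\<close>)

text \<open>Knaster--Tarski: the pointwise infimum of all supersolutions below \<open>w\<close> is a solution.\<close>

lemma scheme_solution_below_supersolution:
  assumes N: "N \<ge> 1" and w0: "\<And>y. y \<in> grid N \<Longrightarrow> 0 \<le> w y"
    and w: "\<And>x \<alpha>. \<lbrakk>x \<in> inner_grid N; \<alpha> \<in> A\<rbrakk> \<Longrightarrow> scheme_term N x w \<alpha> \<le> w x"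
  obtains v where "scheme_solution f A g N v" "\<And>y. y \<in> grid N \<Longrightarrow> v y \<le> w y"
proof -
  define T where "T v x = (if x \<in> inner_grid N then SUP \<alpha>\<in>A. scheme_term N x v \<alpha> else 0)" for v x
  have T_mono: "T v x \<le> T v' x" if v: "\<And>y. y \<in> grid N \<Longrightarrow> 0 \<le> v y" "\<And>y. y \<in> grid N \<Longrightarrow> v y \<le> v' y" for v v' x
  proof (cases "x \<in> inner_grid N")
    case True
    have "(SUP \<alpha>\<in>A. scheme_term N x v \<alpha>) \<le> (SUP \<alpha>\<in>A. scheme_term N x v' \<alpha>)"
    proof (rule cSUP_mono[OF A_nonempty bdd_above_scheme_term[OF N True]])
      show "\<exists>\<beta>\<in>A. scheme_term N x v \<alpha> \<le> scheme_term N x v' \<beta>" if "\<alpha> \<in> A" for \<alpha>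
        using scheme_term_mono[OF N that True v] that by (rule rev_bexI[rotated])
    qed
    then show ?thesis using True by (simp add: T_def)
  qed (simp add: T_def)
  have T0: "0 \<le> T v x" for v x
  proof -
    obtain \<alpha> where "\<alpha> \<in> A" using A_nonempty by blast
    then show ?thesis
      using cSUP_upper[OF \<open>\<alpha> \<in> A\<close> bdd_above_scheme_term[OF N], of x v] scheme_term_nonneg[of \<alpha> x N v]
      by (auto simp: T_def)
  qed
  \<comment> \<open>Restricted to functions between 0 and \<open>w\<close>, since the operator is
    known to be monotone only above 0.\<close>
  define S where "S = {v. \<forall>y\<in>grid N. 0 \<le> v y \<and> v y \<le> w y \<and> T v y \<le> v y}"
  have "w \<in> S"
    using w0 w A_nonempty by (auto simp: S_def T_def intro!: cSUP_least)
  define m where "m y = (INF v\<in>S. v y)" for y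
  have m_le: "m y \<le> v y" if "v \<in> S" "y \<in> grid N" for v y
    unfolding m_def using that
    by (intro cINF_lower[OF _ that(1)]) (auto simp: S_def bdd_below_def)
  have m_ge: "c \<le> m y" if "\<And>v. v \<in> S \<Longrightarrow> c \<le> v y" for c y
    unfolding m_def using that \<open>w \<in> S\<close> by (intro cINF_greatest) auto
  have m0: "0 \<le> m y" if "y \<in> grid N" for y
    using that by (intro m_ge) (auto simp: S_def)
  have Tm: "T m y \<le> m y" if y: "y \<in> grid N" for y
  proof (rule m_ge)
    fix v assume v: "v \<in> S"
    have "T m y \<le> T v y" using m0 m_le[OF v] by (intro T_mono) auto
    also have "\<dots> \<le> v y" using v y by (auto simp: S_def)
    finally show "T m y \<le> v y" .
  qed
  \<comment> \<open>Applying the operator to \<open>T m \<le> m\<close> shows that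
    \<open>T m\<close> is itself a supersolution, so the infimum \<open>m\<close> lies below
    it.\<close>
  have "T m \<in> S"
    using T0 Tm m_le[OF \<open>w \<in> S\<close>] T_mono[of "T m" m] unfolding S_def by (blast intro: order_trans)
  then have eq: "T m y = m y" if "y \<in> grid N" for y
    using Tm m_le that by (intro antisym) auto
  show ?thesis
  proof (rule that[of m])
    show "scheme_solution f A g N m"
      unfolding scheme_solution_iff
    proof (intro conjI ballI impI)
      show "m x = (SUP \<alpha>\<in>A. scheme_term N x m \<alpha>)" if "x \<in> inner_grid N" for x
        using eq[OF inner_grid_in_grid[OF that]] that by (simp add: T_def)
      show "m x = 0" if "x \<in> grid N" "x \<notin> inner_grid N" for x
        using eq[OF that(1)] that(2) by (simp add: T_def)
    qed
  qed (use m_le[OF \<open>w \<in> S\<close>] in auto)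
qed

text \<open>A quadratic shifts exactly up to K h^2 |\<alpha>|^2, so half of \<open>\<kappa>\<close>
  absorbs the modulus from \<open>cond_G4\<close> and half this remainder, \<open>A\<close> being
  bounded. The threshold for \<open>N\<close> depends on the coefficients and on \<open>L\<close>,
  but not on \<open>\<xi>\<close>, \<open>x\<close> or \<open>\<alpha>\<close>.\<close>

lemma consistency_quad:
  assumes "L > 0" "\<kappa> > 0"
  shows "\<forall>\<^sub>F N in sequentially. N \<ge> 1 \<and> (\<forall>\<xi> x \<alpha>. \<bar>\<xi>\<bar> \<le> L \<longrightarrow> x \<in> inner_grid N \<longrightarrow> \<alpha> \<in> A \<longrightarrow>
     \<bar>g N x \<alpha> (\<lambda>y. quad K p q y + \<xi>) - (quad K p q x + \<xi> - mesh N * quad_slope K p q x \<alpha>)\<bar> \<le> mesh N * \<kappa>)"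
proof -
  obtain R where R: "R > 0" "\<And>\<alpha>. \<alpha> \<in> A \<Longrightarrow> norm \<alpha> \<le> R" by (rule A_bounded_above) blast
  obtain \<omega> where \<omega>: "modulus_of_continuity \<omega>" and \<omega>g: "\<And>\<xi> N x \<alpha>. \<lbrakk>\<bar>\<xi>\<bar> \<le> L; N \<ge> 1; x \<in> inner_grid N; \<alpha> \<in> A\<rbrakk> \<Longrightarrow>
      \<bar>(g N x \<alpha> (\<lambda>y. quad K p q y + \<xi>) - quad K p q (x - mesh N *\<^sub>R \<alpha>) - \<xi>) / mesh N\<bar> \<le> \<omega> (mesh N)"
    using G4[unfolded cond_G4_def, rule_format, OF smooth_quad[of K p q] assms(1)] by blast
  have N1: "\<forall>\<^sub>F N in sequentially. N \<ge> (1::nat)" by (rule eventually_ge_at_top)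
  have "filterlim mesh (at_right 0) sequentially"
    unfolding filterlim_at
    by (intro conjI mesh_tendsto_0 eventually_mono[OF N1]) (auto simp: mesh_def)
  then have "(\<lambda>N. \<omega> (mesh N)) \<longlonglongrightarrow> 0"
    using \<omega> filterlim_compose unfolding modulus_of_continuity_def by blast
  then have "\<forall>\<^sub>F N in sequentially. \<omega> (mesh N) < \<kappa> / 2"
    using order_tendstoD(2)[of _ 0] assms(2) by (metis half_gt_zero)
  moreover have "\<forall>\<^sub>F N in sequentially. mesh N < \<kappa> / 2 / (\<bar>K\<bar> * R\<^sup>2 + 1)"
    using assms(2) by (intro eventually_mesh_less divide_pos_pos) (auto intro: add_nonneg_pos)
  ultimately show ?thesis
    using N1
  proof eventually_elim
    case (elim N)
    note h = mesh_pos[OF elim(3)]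
    show ?case
    proof (intro conjI allI impI)
      fix \<xi> x \<alpha> assume *: "\<bar>\<xi>\<bar> \<le> L" "x \<in> inner_grid N" "\<alpha> \<in> A"
      define E where "E = g N x \<alpha> (\<lambda>y. quad K p q y + \<xi>) - quad K p q (x - mesh N *\<^sub>R \<alpha>) - \<xi>"
      have "\<bar>E\<bar> / mesh N \<le> \<omega> (mesh N)"
        using \<omega>g[OF *(1) elim(3) *(2,3)] h by (simp add: E_def abs_divide)
      then have "\<bar>E\<bar> / mesh N \<le> \<kappa> / 2" using elim(1) by linarith
      then have E: "\<bar>E\<bar> \<le> mesh N * (\<kappa> / 2)" using pos_divide_le_eq[OF h] by (metis mult.commute)
      define Z where "Z = K * (mesh N)\<^sup>2 * ((fst \<alpha>)\<^sup>2 + (snd \<alpha>)\<^sup>2)"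
      have "(fst \<alpha>)\<^sup>2 + (snd \<alpha>)\<^sup>2 = (norm \<alpha>)\<^sup>2" by (simp add: norm_prod_def)
      also have "\<dots> \<le> R\<^sup>2" using R(2)[OF *(3)] by (intro power_mono) auto
      finally have "\<bar>K\<bar> * ((fst \<alpha>)\<^sup>2 + (snd \<alpha>)\<^sup>2) \<le> \<bar>K\<bar> * R\<^sup>2" by (rule mult_left_mono) simp
      then have "mesh N * (\<bar>K\<bar> * ((fst \<alpha>)\<^sup>2 + (snd \<alpha>)\<^sup>2)) \<le> mesh N * (\<bar>K\<bar> * R\<^sup>2 + 1)"
        using h by (intro mult_left_mono) auto
      also have "\<dots> \<le> \<kappa> / 2"
      proof -
        have "0 < \<bar>K\<bar> * R\<^sup>2 + 1" by (simp add: add_nonneg_pos)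
        from pos_less_divide_eq[OF this] elim(2) show ?thesis by (metis less_imp_le)
      qed
      finally have "mesh N * (mesh N * (\<bar>K\<bar> * ((fst \<alpha>)\<^sup>2 + (snd \<alpha>)\<^sup>2))) \<le> mesh N * (\<kappa> / 2)"
        using h by (intro mult_left_mono) auto
      moreover have "\<bar>Z\<bar> = mesh N * (mesh N * (\<bar>K\<bar> * ((fst \<alpha>)\<^sup>2 + (snd \<alpha>)\<^sup>2)))"
        using h by (simp add: Z_def abs_mult power2_eq_square[of "mesh N"])
      ultimately have Z: "\<bar>Z\<bar> \<le> mesh N * (\<kappa> / 2)" by simp
      have "g N x \<alpha> (\<lambda>y. quad K p q y + \<xi>) - (quad K p q x + \<xi> - mesh N * quad_slope K p q x \<alpha>) = E + Z"
        by (simp add: E_def Z_def quad_shift)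
      then show "\<bar>g N x \<alpha> (\<lambda>y. quad K p q y + \<xi>) - (quad K p q x + \<xi> - mesh N * quad_slope K p q x \<alpha>)\<bar> \<le> mesh N * \<kappa>"
        using E Z by linarith
    qed (rule elim(3))
  qed
qed

text \<open>The square root in the scheme costs only \<open>O(h\<^sup>2)\<close> because the touching value is at least \<open>\<epsilon>\<close>.\<close>

lemma scheme_term_less_of_touching_above:
  assumes "L > 0" "\<kappa> > 0" "\<epsilon> > 0"
  shows "\<forall>\<^sub>F N in sequentially. \<forall>\<xi> x v. \<bar>\<xi>\<bar> \<le> L \<longrightarrow> x \<in> inner_grid N \<longrightarrow>
     (\<forall>y\<in>grid N. 0 \<le> v y \<and> v y \<le> quad K p q y + \<xi>) \<longrightarrow> \<epsilon> \<le> quad K p q x + \<xi> \<longrightarrow>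
     (\<forall>\<alpha>\<in>A. f x * sqrt (fst \<alpha> * snd \<alpha>) + \<kappa> \<le> quad_slope K p q x \<alpha>) \<longrightarrow>
     (\<forall>\<alpha>\<in>A. scheme_term N x v \<alpha> \<le> quad K p q x + \<xi> - mesh N * \<kappa> / 4)"
proof -
  obtain R where R: "R > 0" "\<And>\<alpha>. \<alpha> \<in> A \<Longrightarrow> norm \<alpha> \<le> R" by (rule A_bounded_above) blast
  obtain F where F: "F > 0" "\<And>x. x \<in> unit_square \<Longrightarrow> f x \<le> F" by (rule f_bounded) blast
  define G where "G = F * R"
  have "G > 0" using R F by (simp add: G_def)
  \<comment> \<open>The factor of h in the smallness condition of
    \<open>scheme_step_less\<close>.\<close>
  define C where "C = G\<^sup>2 + \<kappa> / 4 * (2 * G + \<kappa>)"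
  have "C > 0" using \<open>G > 0\<close> assms by (simp add: C_def add_pos_pos)
  have "\<forall>\<^sub>F N in sequentially. mesh N < \<kappa> / 2 * \<epsilon> / C"
    using assms \<open>C > 0\<close> by (intro eventually_mesh_less) auto
  \<comment> \<open>Half of \<open>\<kappa>\<close> is spent on consistency, the other half is the
    gap required by \<open>scheme_step_less\<close>.\<close>
  moreover have "\<kappa> / 2 > 0" using assms by simp
  note consistency_quad[OF assms(1) this, of K p q]
  ultimately show ?thesis
  proof eventually_elim
    case (elim N)
    then have N: "N \<ge> 1" by blast
    note h = mesh_pos[OF N]
    show ?case
    proof (intro allI impI ballI)
      fix \<xi> x v \<alpha> assume *: "\<bar>\<xi>\<bar> \<le> L" "x \<in> inner_grid N"
        "\<forall>y\<in>grid N. 0 \<le> v y \<and> v y \<le> quad K p q y + \<xi>" "\<epsilon> \<le> quad K p q x + \<xi>"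
        "\<forall>\<alpha>\<in>A. f x * sqrt (fst \<alpha> * snd \<alpha>) + \<kappa> \<le> quad_slope K p q x \<alpha>" and \<alpha>: "\<alpha> \<in> A"
      note x = inner_grid_in_unit_square[OF *(2)]
      define s where "s = sqrt (fst \<alpha> * snd \<alpha>)"
      have s: "0 \<le> s" "s \<le> R"
        using sqrt_mult_le_norm[of \<alpha>] A_nonneg[OF \<alpha>] R(2)[OF \<alpha>] by (auto simp: s_def)
      have fs: "0 \<le> f x * s" "f x * s \<le> G"
        unfolding G_def using s f_nonneg[OF x] F(1) F(2)[OF x] by (auto intro: mult_mono)
      have "g N x \<alpha> v \<le> g N x \<alpha> (\<lambda>y. quad K p q y + \<xi>)"
        using *(2,3) N \<alpha> by (intro g_mono) (auto intro: inner_grid_in_grid)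
      also have "\<dots> \<le> quad K p q x + \<xi> - mesh N * quad_slope K p q x \<alpha> + mesh N * (\<kappa> / 2)"
        using elim(2)[THEN conjunct2, rule_format, OF *(1,2) \<alpha>] by linarith
      also have "\<dots> \<le> quad K p q x + \<xi> - mesh N * (f x * s + \<kappa>) + mesh N * (\<kappa> / 2)"
        using *(5) \<alpha> h by (simp add: s_def)
      finally have g: "g N x \<alpha> v \<le> quad K p q x + \<xi> - mesh N * (f x * s) - mesh N * \<kappa> / 2"
        by (simp add: algebra_simps)
      have "mesh N * (f x * s) + sqrt ((mesh N * (f x * s))\<^sup>2 + (g N x \<alpha> v)\<^sup>2)
          \<le> quad K p q x + \<xi> - mesh N * \<kappa> / 4"
      proof (rule scheme_step_less[where G = G and \<epsilon> = \<epsilon>])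
        show "mesh N * (G\<^sup>2 + \<kappa> / 4 * (2 * G + \<kappa>)) \<le> \<kappa> / 2 * \<epsilon>"
          using elim(1) \<open>C > 0\<close> unfolding C_def[symmetric] by (simp add: field_simps)
        show "0 \<le> g N x \<alpha> v" using *(2,3) N \<alpha> by (intro g_ge_const) (auto intro: inner_grid_in_grid)
      qed (use h assms fs g * in auto)
      then show "scheme_term N x v \<alpha> \<le> quad K p q x + \<xi> - mesh N * \<kappa> / 4"
        unfolding scheme_term_eq[OF \<alpha>] s_def by (simp add: mult.assoc)
    qed
  qed
qed

text \<open>Here the root is simply bounded below by \<open>g N x \<alpha> v\<close>, of whatever
  sign, so no lower bound on the touching value enters.\<close>

lemma scheme_term_ge_of_touching_below:
  assumes "L > 0" "\<kappa> > 0"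
  shows "\<forall>\<^sub>F N in sequentially. \<forall>\<xi> x v \<alpha>. \<bar>\<xi>\<bar> \<le> L \<longrightarrow> x \<in> inner_grid N \<longrightarrow> \<alpha> \<in> A \<longrightarrow>
     (\<forall>y\<in>grid N. quad K p q y + \<xi> \<le> v y) \<longrightarrow>
     quad K p q x + \<xi> + mesh N * (f x * sqrt (fst \<alpha> * snd \<alpha>) - quad_slope K p q x \<alpha> - \<kappa>) \<le> scheme_term N x v \<alpha>"
  using consistency_quad[OF assms, of K p q]
proof eventually_elim
  case (elim N)
  then have N: "N \<ge> 1" by blast
  show ?case
  proof (intro allI impI)
    fix \<xi> x v \<alpha> assume *: "\<bar>\<xi>\<bar> \<le> L" "x \<in> inner_grid N" "\<alpha> \<in> A" "\<forall>y\<in>grid N. quad K p q y + \<xi> \<le> v y"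
    have "quad K p q x + \<xi> - mesh N * quad_slope K p q x \<alpha> - mesh N * \<kappa> \<le> g N x \<alpha> (\<lambda>y. quad K p q y + \<xi>)"
      using elim[THEN conjunct2, rule_format, OF *(1,2,3)] by linarith
    also have "\<dots> \<le> g N x \<alpha> v"
      using *(2,3,4) N by (intro g_mono) (auto intro: inner_grid_in_grid)
    also have "\<dots> \<le> sqrt ((mesh N * f x * sqrt (fst \<alpha> * snd \<alpha>))\<^sup>2 + (g N x \<alpha> v)\<^sup>2)"
      by (rule real_le_rsqrt) simp
    finally show "quad K p q x + \<xi> + mesh N * (f x * sqrt (fst \<alpha> * snd \<alpha>) - quad_slope K p q x \<alpha> - \<kappa>) \<le> scheme_term N x v \<alpha>"
      unfolding scheme_term_eq[OF *(3)] by (simp add: algebra_simps)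
  qed
qed

end

section \<open>Convergence\<close>

definition sqdist :: "real \<times> real \<Rightarrow> real \<times> real \<Rightarrow> real" where
  "sqdist x y = (fst x - fst y)\<^sup>2 + (snd x - snd y)\<^sup>2"

lemma sqdist_nonneg: "0 \<le> sqdist x y"
  by (simp add: sqdist_def)

lemma sqdist_eq_norm: "sqdist x y = (norm (x - y))\<^sup>2"
  by (simp add: sqdist_def norm_prod_def)

text \<open>Cost of rounding the second variable: the square has slope at most 2 on the differences
  that occur, and there are two coordinates.\<close>

lemma sqdist_perturb:
  assumes "x \<in> unit_square" "y \<in> unit_square" "z \<in> unit_square"
    and "\<bar>fst y - fst z\<bar> \<le> r" "\<bar>snd y - snd z\<bar> \<le> r"
  shows "sqdist x z \<le> sqdist x y + 4 * r"
proof -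
  have *: "(a - c)\<^sup>2 \<le> (a - b)\<^sup>2 + 2 * r" if "0 \<le> a" "a \<le> 1" "0 \<le> b" "b \<le> 1" "0 \<le> c" "c \<le> 1" "\<bar>b - c\<bar> \<le> r"
    for a b c :: real
  proof -
    have "(a - c)\<^sup>2 - (a - b)\<^sup>2 = (b - c) * (2 * a - b - c)"
      by (simp add: power2_eq_square algebra_simps)
    also have "\<dots> \<le> \<bar>b - c\<bar> * \<bar>2 * a - b - c\<bar>" by (metis abs_ge_self abs_mult)
    also have "\<dots> \<le> r * 2" using that by (intro mult_mono) auto
    finally show ?thesis by simp
  qed
  show ?thesis
    using *[of "fst x" "fst y" "fst z"] *[of "snd x" "snd y" "snd z"] assms
    by (simp add: sqdist_def unit_square_def mem_Times_iff)
qed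

text \<open>Explains the weight used for the penalty: if the penalty at a maximiser is at most
  \<open>B\<close>, its two points lie within \<open>m\<close> of each other.\<close>

lemma norm_le_of_penalty:
  assumes "0 < B" "0 < m" "B / m\<^sup>2 * sqdist x y \<le> B"
  shows "norm (x - y) \<le> m"
proof -
  have "(norm (x - y))\<^sup>2 \<le> m\<^sup>2"
    using assms by (simp add: sqdist_eq_norm field_simps)
  then show ?thesis using assms(2) power2_le_imp_le by force
qed

text \<open>The centre \<open>y\<close> of the penalty is absorbed into the linear coefficients and
  a constant, so each \<open>y\<close> contributes one test function.\<close>

lemma quad_centred:
  "quad K (s - 2 * K * fst y) (s - 2 * K * snd y) x = K * sqdist x y + s * (fst x + snd x) - K * ((fst y)\<^sup>2 + (snd y)\<^sup>2)"
  by (simp add: quad_def sqdist_def power2_eq_square algebra_simps)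

lemma quad_centred_slope:
  "quad_slope K (s - 2 * K * fst y) (s - 2 * K * snd y) x \<alpha>
    = 2 * K * ((fst x - fst y) * fst \<alpha> + (snd x - snd y) * snd \<alpha>) + s * (fst \<alpha> + snd \<alpha>)"
  by (simp add: quad_slope_def algebra_simps)

lemma sqdist_shift:
  "sqdist x (y - v) = sqdist x y + 2 * ((fst x - fst y) * fst v + (snd x - snd y) * snd v) + (norm v)\<^sup>2"
  by (simp add: sqdist_def norm_prod_def power2_eq_square algebra_simps)

text \<open>Independent of both points; it supplies the range \<open>L\<close> for the shift that
  makes the test function touch the solution.\<close>

lemma abs_quad_centred_le:
  assumes "x \<in> unit_square" "y \<in> unit_square"
  shows "\<bar>quad K (s - 2 * K * fst y) (s - 2 * K * snd y) x\<bar> \<le> 4 * \<bar>K\<bar> + 2 * \<bar>s\<bar>"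
proof -
  have sq: "0 \<le> fst x" "fst x \<le> 1" "0 \<le> snd x" "snd x \<le> 1" "0 \<le> fst y" "fst y \<le> 1" "0 \<le> snd y" "snd y \<le> 1"
    using assms by (auto simp: unit_square_def mem_Times_iff)
  have "(fst x - fst y)\<^sup>2 \<le> 1" "(snd x - snd y)\<^sup>2 \<le> 1"
    using sq by (auto simp: abs_square_le_1)
  then have "sqdist x y \<le> 2" by (simp add: sqdist_def)
  then have 1: "\<bar>K * sqdist x y\<bar> \<le> \<bar>K\<bar> * 2"
    unfolding abs_mult using sqdist_nonneg[of x y] by (intro mult_left_mono) auto
  have "(fst y)\<^sup>2 \<le> 1" "(snd y)\<^sup>2 \<le> 1" using sq by (auto simp: abs_square_le_1)
  then have 2: "\<bar>K * ((fst y)\<^sup>2 + (snd y)\<^sup>2)\<bar> \<le> \<bar>K\<bar> * 2"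
    unfolding abs_mult by (intro mult_left_mono) auto
  have 3: "\<bar>s * (fst x + snd x)\<bar> \<le> \<bar>s\<bar> * 2"
    unfolding abs_mult using sq by (intro mult_left_mono) auto
  show ?thesis unfolding quad_centred using 1 2 3 by linarith
qed

lemma finite_pairs_maximizer:
  fixes \<Phi> :: "'a \<times> 'b \<Rightarrow> real"
  assumes "finite X" "X \<noteq> {}" "finite Y" "Y \<noteq> {}"
  obtains x y where "x \<in> X" "y \<in> Y" "\<And>x' y'. \<lbrakk>x' \<in> X; y' \<in> Y\<rbrakk> \<Longrightarrow> \<Phi> (x', y') \<le> \<Phi> (x, y)"
proof -
  have fin: "finite (\<Phi> ` (X \<times> Y))" "\<Phi> ` (X \<times> Y) \<noteq> {}" using assms by auto
  obtain z where z: "z \<in> X \<times> Y" "\<Phi> z = Max (\<Phi> ` (X \<times> Y))" using Max_in[OF fin] by auto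
  show ?thesis
    by (rule that[of "fst z" "snd z"]) (use z Max_ge[OF fin(1)] in auto)
qed

lemma abs_components_le_norm:
  "\<bar>fst (v :: real \<times> real)\<bar> \<le> norm v" "\<bar>snd v\<bar> \<le> norm v"
  using norm_fst_le[of "fst v" "snd v"] norm_snd_le[of "snd v" "fst v"] by simp_all

lemma norm_le_abs_fst_plus_abs_snd: "norm (v :: real \<times> real) \<le> \<bar>fst v\<bar> + \<bar>snd v\<bar>"
  unfolding norm_prod_def real_norm_def by (metis power2_abs sqrt_sum_squares_le_sum_abs)

section \<open>Linear barriers and uniform bounds on the solutions\<close>

locale scheme_solutions = scheme f A g for f A g +
  fixes u :: "nat \<Rightarrow> real \<times> real \<Rightarrow> real"
  assumes solution: "N \<ge> 1 \<Longrightarrow> the_scheme_solution f A g N (u N)"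
begin

lemma weighted_mean_ge_reward:
  assumes "\<alpha> \<in> A" "x \<in> unit_square" "c > 0" "0 \<le> F" "\<And>x. x \<in> unit_square \<Longrightarrow> f x \<le> F"
  shows "f x * sqrt (fst \<alpha> * snd \<alpha>) \<le> F * c / 2 * fst \<alpha> + F / (2 * c) * snd \<alpha>"
proof -
  have "f x * sqrt (fst \<alpha> * snd \<alpha>) \<le> F * ((c * fst \<alpha> + snd \<alpha> / c) / 2)"
    using assms A_nonneg[OF assms(1)] sqrt_mult_le_weighted_mean[of "fst \<alpha>" "snd \<alpha>" c]
    by (intro mult_mono) auto
  then show ?thesis by (simp add: field_simps)
qed

text \<open>The weighted mean inequality makes one linear slope dominate the reward in every
  direction, and \<open>s\<close> adds a margin of \<open>s * r\<close>. The constant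
  \<open>e\<close> keeps the barrier at the positive level that the square root requires. The free
  weight \<open>c\<close> tilts the barrier: large \<open>c\<close> makes it steep in the first
  coordinate and flatter in the second.\<close>

lemma solution_le_linear_barrier:
  fixes c s e F :: real
  assumes "c > 0" "s > 0" "e > 0" "0 \<le> F" and F: "\<forall>x\<in>unit_square. f x \<le> F"
  shows "\<forall>\<^sub>F N in sequentially. \<forall>x\<in>grid N. u N x \<le> (F * c / 2 + s) * fst x + (F / (2 * c) + s) * snd x + e"
proof -
  obtain r where r: "r > 0" "\<And>\<alpha>. \<alpha> \<in> A \<Longrightarrow> r \<le> norm \<alpha>" by (rule A_bounded_below) blast
  define p where "p = F * c / 2 + s"
  define q where "q = F / (2 * c) + s"
  have pq: "0 \<le> p" "0 \<le> q" using assms by (auto simp: p_def q_def)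
  have slope: "f x * sqrt (fst \<alpha> * snd \<alpha>) + s * r \<le> quad_slope 0 p q x \<alpha>"
    if "\<alpha> \<in> A" "x \<in> unit_square" for \<alpha> x
  proof -
    have "s * r \<le> s * (fst \<alpha> + snd \<alpha>)"
      using norm_le_fst_plus_snd[of \<alpha>] A_nonneg[OF that(1)] r(2)[OF that(1)] assms(2)
      by (intro mult_left_mono) auto
    then show ?thesis
      using weighted_mean_ge_reward[OF that assms(1,4)] F
      by (simp add: quad_slope_def p_def q_def algebra_simps)
  qed
  have "s * r > 0" using assms r by simp
  from scheme_term_less_of_touching_above[OF \<open>e > 0\<close> this \<open>e > 0\<close>, of 0 p q]
  show ?thesis
    using eventually_ge_at_top[of "1::nat"]
  proof eventually_elim
    case (elim N)
    define w where "w y = quad 0 p q y + e" for y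
    have w0: "0 \<le> w y \<and> e \<le> w y" if "y \<in> unit_square" for y
      using pq that assms(3) by (auto simp: w_def quad_def unit_square_def mem_Times_iff)
    obtain v where v: "scheme_solution f A g N v" "\<And>y. y \<in> grid N \<Longrightarrow> v y \<le> w y"
    proof (rule scheme_solution_below_supersolution[OF elim(2), of w])
      fix x \<alpha> assume x: "x \<in> inner_grid N" and \<alpha>: "\<alpha> \<in> A"
      \<comment> \<open>The barrier serves as its own test function, touching itself with the shift
        \<open>e\<close>.\<close>
      have "scheme_term N x w \<alpha> \<le> quad 0 p q x + e - mesh N * (s * r) / 4"
      proof (rule elim(1)[rule_format, OF _ x _ _ _ \<alpha>])
        show "\<And>y. y \<in> grid N \<Longrightarrow> 0 \<le> w y \<and> w y \<le> quad 0 p q y + e"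
          using w0 grid_subset_unit_square[of N] by (auto simp: w_def)
        show "e \<le> quad 0 p q x + e"
          using w0[OF inner_grid_in_unit_square[OF x]] by (simp add: w_def)
      qed (use slope inner_grid_in_unit_square[OF x] assms(3) in auto)
      also have "\<dots> \<le> w x" using mesh_pos[OF elim(2)] \<open>s * r > 0\<close> by (simp add: w_def)
      finally show "scheme_term N x w \<alpha> \<le> w x" .
    qed (use w0 grid_subset_unit_square[of N] in auto)
    show ?case
    proof
      fix x assume "x \<in> grid N"
      then have "u N x = v x" using solution[OF elim(2)] v(1) by (simp add: the_scheme_solution_def)
      then show "u N x \<le> (F * c / 2 + s) * fst x + (F / (2 * c) + s) * snd x + e"
        using v(2)[OF \<open>x \<in> grid N\<close>] by (simp add: w_def quad_def p_def q_def)
    qed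
  qed
qed

text \<open>A barrier of slope \<open>P\<close> in one coordinate and \<open>e / 4\<close> in the
  other stays below \<open>e\<close> unless the first is at least \<open>e / (2 * P)\<close>.
  Replacing \<open>c\<close> by \<open>1 / c\<close> exchanges the axes.\<close>

lemma solution_small_near_axes:
  assumes "e > 0"
  obtains \<kappa>0 where "\<kappa>0 > 0"
    "\<forall>\<^sub>F N in sequentially. \<forall>x\<in>grid N. e \<le> u N x \<longrightarrow> \<kappa>0 \<le> fst x \<and> \<kappa>0 \<le> snd x"
proof -
  obtain F where F: "F > 0" "\<forall>x\<in>unit_square. f x \<le> F" using f_bounded by metis
  \<comment> \<open>Makes F / (2 c) = e / 8, so that the flat coordinate and the constant term
    together contribute at most e / 2.\<close>
  define c where "c = 4 * F / e"
  have "c > 0" using F \<open>e > 0\<close> by (simp add: c_def)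
  define P where "P = F * c / 2 + e / 8"
  have "P > 0" using F \<open>e > 0\<close> \<open>c > 0\<close> by (simp add: P_def add_pos_pos)
  have Q: "F / (2 * c) + e / 8 = e / 4" "F * (1 / c) / 2 + e / 8 = e / 4"
    using F \<open>e > 0\<close> by (auto simp: c_def field_simps)
  have P': "F / (2 * (1 / c)) + e / 8 = P" using \<open>c > 0\<close> by (simp add: P_def field_simps)
  have "e / 8 > 0" "e / 4 > 0" "1 / c > 0" using \<open>e > 0\<close> \<open>c > 0\<close> by auto
  note b1 = solution_le_linear_barrier[OF \<open>c > 0\<close> this(1,2) less_imp_le[OF F(1)] F(2)]
    and b2 = solution_le_linear_barrier[OF this(3,1,2) less_imp_le[OF F(1)] F(2)]
  have "\<forall>\<^sub>F N in sequentially. \<forall>x\<in>grid N. e \<le> u N x \<longrightarrow> e / (2 * P) \<le> fst x \<and> e / (2 * P) \<le> snd x"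
    using b1 b2
  proof eventually_elim
    case (elim N)
    show ?case
    proof (intro ballI impI)
      fix x assume x: "x \<in> grid N" "e \<le> u N x"
      have sq: "fst x \<le> 1" "snd x \<le> 1"
        using x(1) grid_subset_unit_square[of N] by (auto simp: unit_square_def mem_Times_iff)
      have "u N x \<le> P * fst x + e / 4 * snd x + e / 4"
        using bspec[OF elim(1) x(1)] unfolding Q(1) P_def .
      moreover have "e / 4 * snd x \<le> e / 4" "e / 4 * fst x \<le> e / 4" using sq \<open>e > 0\<close> by simp_all
      ultimately have 1: "e / 2 \<le> P * fst x" using x(2) by linarith
      have "u N x \<le> e / 4 * fst x + P * snd x + e / 4"
        using bspec[OF elim(2) x(1)] unfolding Q(2) P' .
      then have 2: "e / 2 \<le> P * snd x"
        using x(2) \<open>e / 4 * fst x \<le> e / 4\<close> by linarith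
      show "e / (2 * P) \<le> fst x \<and> e / (2 * P) \<le> snd x"
        using 1 2 \<open>P > 0\<close> by (simp add: field_simps)
    qed
  qed
  moreover have "e / (2 * P) > 0" using \<open>e > 0\<close> \<open>P > 0\<close> by simp
  ultimately show ?thesis using that by blast
qed

lemma solution_bounded:
  obtains B where "B > 0" "\<forall>\<^sub>F N in sequentially. \<forall>x\<in>grid N. u N x \<le> B"
proof -
  obtain F where F: "F > 0" "\<forall>x\<in>unit_square. f x \<le> F" using f_bounded by metis
  have "\<forall>\<^sub>F N in sequentially. \<forall>x\<in>grid N. u N x \<le> 2 * F + 3"
    using solution_le_linear_barrier[OF zero_less_one zero_less_one zero_less_one less_imp_le[OF F(1)] F(2)]
  proof eventually_elim
    case (elim N)
    show ?case
    proof
      fix x assume x: "x \<in> grid N"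
      have "fst x \<le> 1" "snd x \<le> 1"
        using x(1) grid_subset_unit_square[of N] by (auto simp: unit_square_def mem_Times_iff)
      moreover define P where "P = F / 2 + 1"
      ultimately have "P * fst x \<le> P" "P * snd x \<le> P"
        using F(1) by (simp_all add: mult_left_le)
      moreover have "u N x \<le> P * fst x + P * snd x + 1"
        using bspec[OF elim x] by (simp add: P_def)
      ultimately have "u N x \<le> 2 * P + 1" by linarith
      then show "u N x \<le> 2 * F + 3" using F(1) by (simp add: P_def)
    qed
  qed
  then show ?thesis using that[of "2 * F + 3"] F by simp
qed

lemma scheme_solution_u: "N \<ge> 1 \<Longrightarrow> scheme_solution f A g N (u N)"
  using solution by (simp add: the_scheme_solution_def)

lemma u_nonneg: "\<lbrakk>N \<ge> 1; x \<in> grid N\<rbrakk> \<Longrightarrow> 0 \<le> u N x"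
  using scheme_solution_nonneg scheme_solution_u by blast

lemma u_eq_0: "\<lbrakk>N \<ge> 1; x \<in> grid N; x \<notin> inner_grid N\<rbrakk> \<Longrightarrow> u N x = 0"
  using scheme_solution_u by (simp add: scheme_solution_iff)

section \<open>Doubling of variables\<close>

text \<open>Doubling of variables, with the second variable restricted to a fixed finite grid so that
  only finitely many test functions enter the consistency condition.\<close>

lemma slope_bound_at_touching_above:
  assumes "L > 0" "\<kappa> > 0" "\<epsilon> > 0" "finite Y"
  shows "\<forall>\<^sub>F N in sequentially. \<forall>y\<in>Y. \<forall>x\<in>inner_grid N.
     (\<forall>z\<in>grid N. u N z - K * sqdist z y - s * (fst z + snd z) \<le> u N x - K * sqdist x y - s * (fst x + snd x)) \<longrightarrow>
     \<epsilon> \<le> u N x \<longrightarrow> \<bar>u N x - quad K (s - 2 * K * fst y) (s - 2 * K * snd y) x\<bar> \<le> L \<longrightarrow>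
     (\<exists>\<alpha>\<in>A. 2 * K * ((fst x - fst y) * fst \<alpha> + (snd x - snd y) * snd \<alpha>) + s * (fst \<alpha> + snd \<alpha>)
        < f x * sqrt (fst \<alpha> * snd \<alpha>) + \<kappa>)"
proof (rule eventually_ball_finite[OF assms(4)], rule ballI)
  fix y assume "y \<in> Y"
  define Q where "Q = quad K (s - 2 * K * fst y) (s - 2 * K * snd y)"
  show "\<forall>\<^sub>F N in sequentially. \<forall>x\<in>inner_grid N.
     (\<forall>z\<in>grid N. u N z - K * sqdist z y - s * (fst z + snd z) \<le> u N x - K * sqdist x y - s * (fst x + snd x)) \<longrightarrow>
     \<epsilon> \<le> u N x \<longrightarrow> \<bar>u N x - quad K (s - 2 * K * fst y) (s - 2 * K * snd y) x\<bar> \<le> L \<longrightarrow>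
     (\<exists>\<alpha>\<in>A. 2 * K * ((fst x - fst y) * fst \<alpha> + (snd x - snd y) * snd \<alpha>) + s * (fst \<alpha> + snd \<alpha>)
        < f x * sqrt (fst \<alpha> * snd \<alpha>) + \<kappa>)"
    using scheme_term_less_of_touching_above[OF assms(1-3), of K "s - 2 * K * fst y" "s - 2 * K * snd y",
        folded Q_def] eventually_ge_at_top[of "1::nat"]
    unfolding Q_def[symmetric]
  proof eventually_elim
    case (elim N)
    show ?case
    proof (intro ballI impI, rule ccontr)
      fix x assume x: "x \<in> inner_grid N"
        and max: "\<forall>z\<in>grid N. u N z - K * sqdist z y - s * (fst z + snd z) \<le> u N x - K * sqdist x y - s * (fst x + snd x)"
        and \<epsilon>: "\<epsilon> \<le> u N x" and L: "\<bar>u N x - Q x\<bar> \<le> L"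
        and no: "\<not> (\<exists>\<alpha>\<in>A. 2 * K * ((fst x - fst y) * fst \<alpha> + (snd x - snd y) * snd \<alpha>) + s * (fst \<alpha> + snd \<alpha>)
        < f x * sqrt (fst \<alpha> * snd \<alpha>) + \<kappa>)"
      \<comment> \<open>Maximality in \<open>x\<close> says that the penalty, shifted by
        \<open>u N x - Q x\<close>, lies above the solution and meets it at
        \<open>x\<close>.\<close>
      have touch: "0 \<le> u N z \<and> u N z \<le> Q z + (u N x - Q x)" if "z \<in> grid N" for z
        using u_nonneg[OF elim(2) that] bspec[OF max that] unfolding Q_def quad_centred by simp
      have "scheme_term N x (u N) \<alpha> \<le> u N x - mesh N * \<kappa> / 4" if "\<alpha> \<in> A" for \<alpha>
        using elim(1)[rule_format, OF L x touch, of \<alpha>] \<epsilon> no that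
        unfolding Q_def quad_centred_slope by (auto simp: not_less)
      \<comment> \<open>The gap is the same for all \<open>\<alpha>\<close>, so it survives a
        supremum that need not be attained.\<close>
      then have "(SUP \<alpha>\<in>A. scheme_term N x (u N) \<alpha>) \<le> u N x - mesh N * \<kappa> / 4"
        by (intro cSUP_least A_nonempty)
      moreover have "u N x = (SUP \<alpha>\<in>A. scheme_term N x (u N) \<alpha>)"
        using scheme_solution_u[OF elim(2)] x by (simp add: scheme_solution_iff)
      ultimately have "mesh N * \<kappa> \<le> 0" by simp
      then show False using mesh_pos[OF elim(2)] assms(2) by (simp add: mult_le_0_iff)
    qed
  qed
qed

text \<open>The supremum dominates each of its terms, so the estimate holds for every direction in
  \<open>A\<close>, not just for some. \<open>K\<close> and \<open>s\<close> may have either sign;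
  they are later taken negative.\<close>

lemma slope_bound_at_touching_below:
  assumes "L > 0" "\<kappa> > 0" "finite Y"
  shows "\<forall>\<^sub>F N in sequentially. \<forall>y\<in>Y. \<forall>x\<in>inner_grid N.
     (\<forall>z\<in>grid N. u N x - K * sqdist x y - s * (fst x + snd x) \<le> u N z - K * sqdist z y - s * (fst z + snd z)) \<longrightarrow>
     \<bar>u N x - quad K (s - 2 * K * fst y) (s - 2 * K * snd y) x\<bar> \<le> L \<longrightarrow>
     (\<forall>\<alpha>\<in>A. f x * sqrt (fst \<alpha> * snd \<alpha>) - \<kappa>
        \<le> 2 * K * ((fst x - fst y) * fst \<alpha> + (snd x - snd y) * snd \<alpha>) + s * (fst \<alpha> + snd \<alpha>))"
proof (rule eventually_ball_finite[OF assms(3)], rule ballI)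
  fix y assume "y \<in> Y"
  define Q where "Q = quad K (s - 2 * K * fst y) (s - 2 * K * snd y)"
  show "\<forall>\<^sub>F N in sequentially. \<forall>x\<in>inner_grid N.
     (\<forall>z\<in>grid N. u N x - K * sqdist x y - s * (fst x + snd x) \<le> u N z - K * sqdist z y - s * (fst z + snd z)) \<longrightarrow>
     \<bar>u N x - quad K (s - 2 * K * fst y) (s - 2 * K * snd y) x\<bar> \<le> L \<longrightarrow>
     (\<forall>\<alpha>\<in>A. f x * sqrt (fst \<alpha> * snd \<alpha>) - \<kappa>
        \<le> 2 * K * ((fst x - fst y) * fst \<alpha> + (snd x - snd y) * snd \<alpha>) + s * (fst \<alpha> + snd \<alpha>))"
    using scheme_term_ge_of_touching_below[OF assms(1,2), of K "s - 2 * K * fst y" "s - 2 * K * snd y",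
        folded Q_def] eventually_ge_at_top[of "1::nat"]
    unfolding Q_def[symmetric]
  proof eventually_elim
    case (elim N)
    show ?case
    proof (intro ballI impI)
      fix x \<alpha> assume x: "x \<in> inner_grid N" and \<alpha>: "\<alpha> \<in> A"
        and min: "\<forall>z\<in>grid N. u N x - K * sqdist x y - s * (fst x + snd x) \<le> u N z - K * sqdist z y - s * (fst z + snd z)"
        and L: "\<bar>u N x - Q x\<bar> \<le> L"
      define D where "D = quad_slope K (s - 2 * K * fst y) (s - 2 * K * snd y) x \<alpha>"
      have touch: "Q z + (u N x - Q x) \<le> u N z" if "z \<in> grid N" for z
        using bspec[OF min that] unfolding Q_def quad_centred by simp
      have "u N x + mesh N * (f x * sqrt (fst \<alpha> * snd \<alpha>) - D - \<kappa>) \<le> scheme_term N x (u N) \<alpha>"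
        using elim(1)[rule_format, OF L x \<alpha> touch] by (simp add: D_def)
      also have "\<dots> \<le> u N x"
        by (rule scheme_solution_ge_term[OF elim(2) scheme_solution_u[OF elim(2)] x \<alpha>])
      finally have "f x * sqrt (fst \<alpha> * snd \<alpha>) - D - \<kappa> \<le> 0"
        using mesh_pos[OF elim(2)] by (simp add: mult_le_0_iff)
      then show "f x * sqrt (fst \<alpha> * snd \<alpha>) - \<kappa>
        \<le> 2 * K * ((fst x - fst y) * fst \<alpha> + (snd x - snd y) * snd \<alpha>) + s * (fst \<alpha> + snd \<alpha>)"
        unfolding D_def quad_centred_slope by simp
    qed
  qed
qed

text \<open>If the claim failed, the penalised difference \<open>\<Phi>\<close> would have a
  maximiser with value above \<open>2 * e\<close>. The scheme gives one direction
  \<open>\<alpha>\<close> with a small slope at \<open>x\<close>; moving \<open>y\<close> back along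
  the same \<open>\<alpha>\<close>, superadditivity of the value function gives the opposite
  estimate, with errors below \<open>\<delta> * (fst \<alpha> + snd \<alpha>)\<close>.\<close>

lemma solution_le_value_fun:
  assumes "e > 0"
  shows "\<forall>\<^sub>F N in sequentially. \<forall>x\<in>grid N. u N x \<le> value_fun f x + 4 * e"
proof -
  let ?V = "value_fun f"
  obtain a where a: "a > 0" "\<And>\<alpha>. \<alpha> \<in> A \<Longrightarrow> a \<le> norm \<alpha>" by (rule A_bounded_below) blast
  obtain R where R: "R > 0" "\<And>\<alpha>. \<alpha> \<in> A \<Longrightarrow> norm \<alpha> \<le> R" by (rule A_bounded_above) blast
  obtain B where B: "B > 0" "\<forall>\<^sub>F N in sequentially. \<forall>x\<in>grid N. u N x \<le> B" by (rule solution_bounded)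
  obtain \<kappa>0 where \<kappa>0: "\<kappa>0 > 0"
    "\<forall>\<^sub>F N in sequentially. \<forall>x\<in>grid N. e \<le> u N x \<longrightarrow> \<kappa>0 \<le> fst x \<and> \<kappa>0 \<le> snd x"
    by (rule solution_small_near_axes[OF \<open>e > 0\<close>])
  \<comment> \<open>The linear term costs at most \<open>2 * \<delta> = e\<close> on the square and
    rounding at most \<open>e\<close>, so a failure by \<open>4 * e\<close> leaves more than
    \<open>2 * e\<close>.\<close>
  define \<delta> where "\<delta> = e / 2"
  have "\<delta> > 0" using \<open>e > 0\<close> by (simp add: \<delta>_def)
  define \<omega> where "\<omega> = \<delta> / 4"
  have "\<omega> > 0" using \<open>\<delta> > 0\<close> by (simp add: \<omega>_def)
  obtain \<rho> where \<rho>: "\<rho> > 0" "\<And>x y. \<lbrakk>x \<in> unit_square; y \<in> unit_square; norm (x - y) < \<rho>\<rbrakk> \<Longrightarrow> \<bar>f x - f y\<bar> < \<omega>"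
    by (rule f_uniformly_continuous[OF \<open>\<omega> > 0\<close>]) blast
  \<comment> \<open>All points at which \<open>f\<close> is compared lie within \<open>6 * m\<close>
    of \<open>x\<close>, hence the factor 8; the bound by \<open>\<kappa>0 / 2\<close> keeps
    \<open>y\<close> at least \<open>m\<close> away from the axes, so a step back of size
    \<open>m\<close> stays in the square.\<close>
  define m where "m = min (\<rho> / 8) (\<kappa>0 / 2)"
  have m: "m > 0" "m \<le> \<rho> / 8" "m \<le> \<kappa>0 / 2" using \<rho> \<kappa>0 by (auto simp: m_def)
  define K where "K = B / m\<^sup>2"
  have "K > 0" using B m by (simp add: K_def)
  \<comment> \<open>The first bound keeps the step \<open>t *\<^sub>R \<alpha>\<close> within
    \<open>m\<close> in each coordinate, the second limits the curvature error
    \<open>K * t * R\<^sup>2\<close> of the penalty.\<close>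
  define t where "t = min (m / R) (\<delta> * a / 8 / (K * R\<^sup>2))"
  have t: "t > 0" using m R \<open>\<delta> > 0\<close> a \<open>K > 0\<close> by (simp add: t_def)
  have tR: "t * R \<le> m"
  proof -
    have "t * R \<le> m / R * R" using R by (intro mult_right_mono) (auto simp: t_def)
    then show ?thesis using R by simp
  qed
  have tK: "K * t * R\<^sup>2 \<le> \<delta> * a / 8"
  proof -
    have "t * (K * R\<^sup>2) \<le> \<delta> * a / 8 / (K * R\<^sup>2) * (K * R\<^sup>2)"
      using R \<open>K > 0\<close> by (intro mult_right_mono) (auto simp: t_def)
    then show ?thesis using R \<open>K > 0\<close> by (simp add: mult_ac)
  qed
  define \<kappa> where "\<kappa> = \<delta> * a / 8"
  have "\<kappa> > 0" using \<open>\<delta> > 0\<close> a by (simp add: \<kappa>_def)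
  \<comment> \<open>The rounding error will be divided by \<open>t\<close>, hence the factor
    \<open>t\<close>.\<close>
  define \<eta> where "\<eta> = min e (t * \<kappa>)"
  have "\<eta> > 0" using \<open>e > 0\<close> t \<open>\<kappa> > 0\<close> by (simp add: \<eta>_def)
  obtain n where n: "n \<ge> 1" "mesh n < \<eta> / (4 * K)"
  proof -
    have "\<forall>\<^sub>F n in sequentially. n \<ge> 1 \<and> mesh n < \<eta> / (4 * K)"
      using \<open>\<eta> > 0\<close> \<open>K > 0\<close> by (intro eventually_conj eventually_ge_at_top eventually_mesh_less) auto
    then show ?thesis using that by (auto dest: eventually_happens)
  qed
  have err: "4 * K * mesh n \<le> \<eta>"
    using n(2) \<open>K > 0\<close> by (simp add: field_simps)
  define L where "L = B + (4 * K + 2 * \<delta>)"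
  have "L > 0" using B \<open>K > 0\<close> \<open>\<delta> > 0\<close> by (simp add: L_def)
  \<comment> \<open>Rounding down cannot raise the value function, so only the penalty has to be
    estimated.\<close>
  have near: "?V z + K * sqdist x z \<le> ?V y + K * sqdist x y + \<eta>"
    if "x \<in> unit_square" "y \<in> unit_square" "z \<in> unit_square" "fst z \<le> fst y" "snd z \<le> snd y"
      "\<bar>fst y - fst z\<bar> \<le> mesh n" "\<bar>snd y - snd z\<bar> \<le> mesh n" for x y z
  proof -
    have "K * sqdist x z \<le> K * (sqdist x y + 4 * mesh n)"
      using sqdist_perturb[OF that(1,2,3,6,7)] \<open>K > 0\<close> by (intro mult_left_mono) auto
    moreover have "?V z \<le> ?V y" using that by (intro value_fun_mono)
    ultimately show ?thesis using err by (simp add: algebra_simps)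
  qed
  show ?thesis
    using slope_bound_at_touching_above[OF \<open>L > 0\<close> \<open>\<kappa> > 0\<close> \<open>e > 0\<close> finite_grid[of n], of K \<delta>]
      B(2) \<kappa>0(2) eventually_ge_at_top[of "1::nat"]
  proof eventually_elim
    case (elim N)
    note N = elim(4)
    define \<Phi> where "\<Phi> = (\<lambda>(x, y). u N x - ?V y - K * sqdist x y - \<delta> * (fst x + snd x))"
    show ?case
    proof (rule ballI, rule ccontr)
      fix x0 assume x0: "x0 \<in> grid N" "\<not> u N x0 \<le> ?V x0 + 4 * e"
      have x0sq: "x0 \<in> unit_square" using x0 grid_subset_unit_square by blast
      obtain x y where xy: "x \<in> grid N" "y \<in> grid n"
        and max: "\<And>x' y'. \<lbrakk>x' \<in> grid N; y' \<in> grid n\<rbrakk> \<Longrightarrow> \<Phi> (x', y') \<le> \<Phi> (x, y)"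
        by (rule finite_pairs_maximizer[OF finite_grid[of N] grid_nonempty finite_grid[of n] grid_nonempty, of \<Phi>]) blast
      have sq: "x \<in> unit_square" "y \<in> unit_square" using xy grid_subset_unit_square by blast+
      have sq': "0 \<le> fst x" "0 \<le> snd x" "fst y \<le> 1" "snd y \<le> 1" "fst x0 \<le> 1" "snd x0 \<le> 1"
        using sq x0sq by (auto simp: unit_square_def mem_Times_iff)
      have pos: "2 * e < \<Phi> (x, y)"
      proof -
        obtain y0 where y0: "y0 \<in> grid n" "fst y0 \<le> fst x0" "snd y0 \<le> snd x0"
          "\<bar>fst x0 - fst y0\<bar> \<le> mesh n" "\<bar>snd x0 - snd y0\<bar> \<le> mesh n"
          using unit_square_floor_grid[OF x0sq n(1)] by blast
        have "?V y0 + K * sqdist x0 y0 \<le> ?V x0 + \<eta>"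
          using near[OF x0sq x0sq _ y0(2-5)] y0(1) grid_subset_unit_square by (auto simp: sqdist_def)
        moreover have "\<delta> * (fst x0 + snd x0) \<le> \<delta> * 2" using sq' \<open>\<delta> > 0\<close> by (intro mult_left_mono) auto
        moreover have "\<eta> \<le> e" by (simp add: \<eta>_def)
        ultimately have "2 * e < \<Phi> (x0, y0)" using x0(2) by (simp add: \<Phi>_def \<delta>_def)
        also have "\<dots> \<le> \<Phi> (x, y)" using max x0 y0 by blast
        finally show ?thesis .
      qed
      have V0: "0 \<le> ?V y" using value_fun_nonneg[OF sq(2)] .
      have pen: "0 \<le> K * sqdist x y" "0 \<le> \<delta> * (fst x + snd x)"
        using \<open>K > 0\<close> sqdist_nonneg[of x y] \<open>\<delta> > 0\<close> sq' by auto
      have ux: "e \<le> u N x" "u N x \<le> B" "K * sqdist x y \<le> B"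
        using pos V0 pen \<open>e > 0\<close> bspec[OF elim(2) xy(1)] by (auto simp: \<Phi>_def)
      have x_in: "x \<in> inner_grid N"
        using u_eq_0[OF N xy(1)] ux(1) \<open>e > 0\<close> by force
      have nxy: "norm (x - y) \<le> m"
        by (rule norm_le_of_penalty[OF B(1) m(1)]) (use ux in \<open>simp add: K_def\<close>)
      have dxy: "\<bar>fst x - fst y\<bar> \<le> m" "\<bar>snd x - snd y\<bar> \<le> m"
        using nxy abs_components_le_norm[of "x - y"] by simp_all
      have "\<kappa>0 \<le> fst x" "\<kappa>0 \<le> snd x" using bspec[OF elim(3) xy(1)] ux(1) by auto
      then have y_far: "m \<le> fst y" "m \<le> snd y" using dxy m by auto
      have max_x: "\<forall>z\<in>grid N. u N z - K * sqdist z y - \<delta> * (fst z + snd z) \<le> u N x - K * sqdist x y - \<delta> * (fst x + snd x)"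
      proof
        fix z assume "z \<in> grid N"
        from max[OF this xy(2)] show "u N z - K * sqdist z y - \<delta> * (fst z + snd z) \<le> u N x - K * sqdist x y - \<delta> * (fst x + snd x)"
          by (simp add: \<Phi>_def)
      qed
      have "\<bar>u N x - quad K (\<delta> - 2 * K * fst y) (\<delta> - 2 * K * snd y) x\<bar> \<le> L"
        using abs_quad_centred_le[OF sq, of K \<delta>] ux \<open>K > 0\<close> \<open>\<delta> > 0\<close> \<open>e > 0\<close> by (simp add: L_def abs_le_iff)
      from elim(1)[rule_format, OF xy(2) x_in _ ux(1) this] max_x
      obtain \<alpha> where \<alpha>: "\<alpha> \<in> A" and slope: "2 * K * ((fst x - fst y) * fst \<alpha> + (snd x - snd y) * snd \<alpha>)
          + \<delta> * (fst \<alpha> + snd \<alpha>) < f x * sqrt (fst \<alpha> * snd \<alpha>) + \<kappa>"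
        by blast
      define q where "q = sqrt (fst \<alpha> * snd \<alpha>)"
      define P where "P = (fst x - fst y) * fst \<alpha> + (snd x - snd y) * snd \<alpha>"
      note \<alpha>0 = A_nonneg[OF \<alpha>]
      have q: "0 \<le> q" "q \<le> fst \<alpha> + snd \<alpha>"
        using \<alpha>0 sqrt_mult_le_norm[OF \<alpha>0] norm_le_fst_plus_snd[OF \<alpha>0] by (auto simp: q_def)
      have \<alpha>R: "fst \<alpha> \<le> R" "snd \<alpha> \<le> R"
        using R(2)[OF \<alpha>] abs_components_le_norm[of \<alpha>] \<alpha>0 by simp_all
      define z where "z = y - t *\<^sub>R \<alpha>"
      have t\<alpha>: "0 \<le> t * fst \<alpha>" "t * fst \<alpha> \<le> m" "0 \<le> t * snd \<alpha>" "t * snd \<alpha> \<le> m"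
        using t \<alpha>0 order_trans[OF mult_left_mono[OF \<alpha>R(1), of t] tR]
          order_trans[OF mult_left_mono[OF \<alpha>R(2), of t] tR] by simp_all
      have zsq: "z \<in> unit_square"
        using t\<alpha> y_far sq' by (auto simp: z_def unit_square_def mem_Times_iff)
      \<comment> \<open>Maximality is known only on the coarse grid, so the point reached by the
        step is rounded back to it.\<close>
      obtain y' where y': "y' \<in> grid n" "fst y' \<le> fst z" "snd y' \<le> snd z"
          "\<bar>fst z - fst y'\<bar> \<le> mesh n" "\<bar>snd z - snd y'\<bar> \<le> mesh n"
        using unit_square_floor_grid[OF zsq n(1)] by blast
      have "?V y + K * sqdist x y \<le> ?V y' + K * sqdist x y'"
        using max[OF xy(1) y'(1)] by (simp add: \<Phi>_def)
      also have "\<dots> \<le> ?V z + K * sqdist x z + \<eta>"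
        using near[OF sq(1) zsq _ y'(2-5)] y'(1) grid_subset_unit_square by blast
      finally have 1: "?V y - ?V z \<le> K * (sqdist x z - sqdist x y) + \<eta>" by (simp add: algebra_simps)
      have "sqdist x z - sqdist x y = 2 * t * P + t\<^sup>2 * (norm \<alpha>)\<^sup>2"
        unfolding z_def sqdist_shift P_def using t by (simp add: power_mult_distrib algebra_simps)
      also have "\<dots> \<le> 2 * t * P + t\<^sup>2 * R\<^sup>2"
        using R(2)[OF \<alpha>] by (intro add_left_mono mult_left_mono power_mono) auto
      finally have "K * (sqdist x z - sqdist x y) \<le> K * (2 * t * P + t\<^sup>2 * R\<^sup>2)"
        using \<open>K > 0\<close> by (intro mult_left_mono) auto
      also have "\<dots> = t * (2 * K * P + K * t * R\<^sup>2)" by (simp add: power2_eq_square algebra_simps)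
      finally have 2: "?V y - ?V z \<le> t * (2 * K * P + K * t * R\<^sup>2) + \<eta>" using 1 by linarith
      \<comment> \<open>A lower bound of \<open>f\<close> near \<open>x\<close>, truncated at 0
        because superadditivity asks for a nonnegative one.\<close>
      define c where "c = max 0 (f x - \<omega>)"
      have "?V z + c * sqrt ((fst y - fst z) * (snd y - snd z)) \<le> ?V y"
      proof (rule value_fun_superadditive[OF zsq sq(2), where \<rho> = m])
        fix w assume w: "w \<in> unit_square" "fst z - m \<le> fst w" "fst w \<le> fst y" "snd z - m \<le> snd w" "snd w \<le> snd y"
        have "\<bar>fst (x - w)\<bar> \<le> 3 * m" "\<bar>snd (x - w)\<bar> \<le> 3 * m"
          using w t\<alpha> dxy by (auto simp: z_def)
        then have "norm (x - w) \<le> 6 * m"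
          using norm_le_abs_fst_plus_abs_snd[of "x - w"] by simp
        then have "\<bar>f x - f w\<bar> < \<omega>" using m \<rho>(1) by (intro \<rho>(2)[OF sq(1) w(1)]) auto
        then show "c \<le> f w" using f_nonneg[OF w(1)] by (auto simp: c_def)
      qed (use t\<alpha> m in \<open>auto simp: z_def c_def\<close>)
      moreover have "sqrt ((fst y - fst z) * (snd y - snd z)) = t * q"
        using t by (simp add: z_def q_def real_sqrt_mult)
      moreover have "(f x - \<omega>) * (t * q) \<le> c * (t * q)"
        using t q by (intro mult_right_mono) (auto simp: c_def)
      ultimately have "t * ((f x - \<omega>) * q) \<le> t * (2 * K * P + K * t * R\<^sup>2) + \<eta>"
        using 2 by (simp add: algebra_simps)
      also have "\<eta> \<le> t * \<kappa>" by (simp add: \<eta>_def)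
      finally have "t * ((f x - \<omega>) * q) \<le> t * (2 * K * P + K * t * R\<^sup>2 + \<kappa>)"
        by (simp add: algebra_simps)
      then have "(f x - \<omega>) * q \<le> 2 * K * P + K * t * R\<^sup>2 + \<kappa>" using t by simp
      moreover have "2 * K * P + \<delta> * (fst \<alpha> + snd \<alpha>) < f x * q + \<kappa>"
        using slope unfolding P_def q_def .
      \<comment> \<open>The three errors \<open>\<kappa>\<close> are consistency, rounding divided
        by \<open>t\<close>, and curvature of the penalty. Together with the oscillation
        \<open>\<omega>\<close> of \<open>f\<close> they use up 5/8 of the slope term on the
        left.\<close>
      ultimately have "\<delta> * (fst \<alpha> + snd \<alpha>) < \<omega> * q + 3 * \<kappa>"
        using tK by (simp add: \<kappa>_def algebra_simps)
      also have "\<dots> \<le> \<delta> / 4 * (fst \<alpha> + snd \<alpha>) + 3 / 8 * (\<delta> * (fst \<alpha> + snd \<alpha>))"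
      proof (rule add_mono)
        show "\<omega> * q \<le> \<delta> / 4 * (fst \<alpha> + snd \<alpha>)"
          using q \<open>\<omega> > 0\<close> by (simp add: \<omega>_def)
        have "a \<le> fst \<alpha> + snd \<alpha>" using a(2)[OF \<alpha>] norm_le_fst_plus_snd[OF \<alpha>0] by linarith
        then show "3 * \<kappa> \<le> 3 / 8 * (\<delta> * (fst \<alpha> + snd \<alpha>))"
          using \<open>\<delta> > 0\<close> by (simp add: \<kappa>_def)
      qed
      also have "\<dots> \<le> \<delta> * (fst \<alpha> + snd \<alpha>)"
        using \<open>\<delta> > 0\<close> \<alpha>0 by (simp add: field_simps)
      finally show False by simp
    qed
  qed
qed

text \<open>The roles change: the scheme bounds the slopes at \<open>x\<close> for all of
  \<open>A\<close>, while the nearly optimal path at \<open>y\<close> yields an increment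
  \<open>v\<close> in no prescribed direction. The slope bound is therefore made homogeneous and
  extended to the whole quadrant before it is applied to \<open>v\<close>.\<close>

lemma value_fun_le_solution:
  assumes "e > 0"
  shows "\<forall>\<^sub>F N in sequentially. \<forall>x\<in>grid N. value_fun f x \<le> u N x + 4 * e"
proof -
  let ?V = "value_fun f"
  obtain a where a: "a > 0" "\<And>\<alpha>. \<alpha> \<in> A \<Longrightarrow> a \<le> norm \<alpha>" by (rule A_bounded_below) blast
  obtain F where F: "F > 0" "\<And>x. x \<in> unit_square \<Longrightarrow> f x \<le> F" by (rule f_bounded) blast
  have V_le: "?V y \<le> F * sqrt (fst y)" "?V y \<le> F * sqrt (snd y)" "?V y \<le> F" if "y \<in> unit_square" for y
  proof -
    have y: "0 \<le> fst y" "fst y \<le> 1" "0 \<le> snd y" "snd y \<le> 1"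
      using that by (auto simp: unit_square_def mem_Times_iff)
    have V: "?V y \<le> F * sqrt (fst y * snd y)" using value_fun_le[OF that less_imp_le[OF F(1)] F(2)] .
    have "fst y * snd y \<le> fst y" "fst y * snd y \<le> snd y" "fst y * snd y \<le> 1"
      using y by (auto simp: mult_left_le mult_left_le_one_le mult_le_one)
    then have "F * sqrt (fst y * snd y) \<le> F * sqrt (fst y)" "F * sqrt (fst y * snd y) \<le> F * sqrt (snd y)"
      "F * sqrt (fst y * snd y) \<le> F * 1"
      using F(1) by (intro mult_left_mono; simp)+
    then show "?V y \<le> F * sqrt (fst y)" "?V y \<le> F * sqrt (snd y)" "?V y \<le> F" using V by auto
  qed
  \<comment> \<open>Distance from the axes forced by a value of at least \<open>e\<close>, as the
    value is at most \<open>F\<close> times the square root of either coordinate.\<close>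
  define \<kappa>0 where "\<kappa>0 = (e / F)\<^sup>2"
  have "\<kappa>0 > 0" using \<open>e > 0\<close> F by (simp add: \<kappa>0_def)
  have far: "\<kappa>0 \<le> fst y" "\<kappa>0 \<le> snd y" if "y \<in> unit_square" "e \<le> ?V y" for y
  proof -
    have y: "0 \<le> fst y" "0 \<le> snd y" using that by (auto simp: unit_square_def mem_Times_iff)
    have "e / F \<le> sqrt (fst y)" "e / F \<le> sqrt (snd y)"
      using V_le[OF that(1)] that(2) F(1) by (simp_all add: divide_le_eq mult.commute)
    then have "\<kappa>0 \<le> (sqrt (fst y))\<^sup>2" "\<kappa>0 \<le> (sqrt (snd y))\<^sup>2"
      unfolding \<kappa>0_def using \<open>e > 0\<close> F(1) by (intro power_mono; simp)+
    then show "\<kappa>0 \<le> fst y" "\<kappa>0 \<le> snd y" using y by simp_all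
  qed
  define \<delta> where "\<delta> = e / 2"
  have "\<delta> > 0" using \<open>e > 0\<close> by (simp add: \<delta>_def)
  define \<omega> where "\<omega> = \<delta> / 8"
  have "\<omega> > 0" using \<open>\<delta> > 0\<close> by (simp add: \<omega>_def)
  obtain \<rho> where \<rho>: "\<rho> > 0" "\<And>x y. \<lbrakk>x \<in> unit_square; y \<in> unit_square; norm (x - y) < \<rho>\<rbrakk> \<Longrightarrow> \<bar>f x - f y\<bar> < \<omega>"
    by (rule f_uniformly_continuous[OF \<open>\<omega> > 0\<close>]) blast
  \<comment> \<open>The points on the last piece of the path are within \<open>t \<le> m\<close> of
    \<open>y\<close>, hence within \<open>2 * m < \<rho>\<close> of \<open>x\<close>.\<close>
  define m where "m = min (\<rho> / 4) (\<kappa>0 / 2)"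
  have m: "m > 0" "m \<le> \<rho> / 4" "m \<le> \<kappa>0 / 2" using \<rho> \<open>\<kappa>0 > 0\<close> by (auto simp: m_def)
  define K where "K = F / m\<^sup>2"
  have "K > 0" using F m by (simp add: K_def)
  define t where "t = min m (\<delta> / 8 / K)"
  have t: "t > 0" "t \<le> m" using m \<open>\<delta> > 0\<close> \<open>K > 0\<close> by (auto simp: t_def)
  have tK: "K * t \<le> \<delta> / 8"
  proof -
    have "K * t \<le> K * (\<delta> / 8 / K)" using \<open>K > 0\<close> by (intro mult_left_mono) (auto simp: t_def)
    then show ?thesis using \<open>K > 0\<close> by simp
  qed
  \<comment> \<open>As every \<open>\<alpha>\<close> in \<open>A\<close> has norm at least
    \<open>a\<close>, this is at most \<open>\<delta> / 8 * norm \<alpha>\<close>, which turns the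
    consistency error into a homogeneous term.\<close>
  define \<kappa> where "\<kappa> = a * \<delta> / 8"
  have "\<kappa> > 0" using \<open>\<delta> > 0\<close> a by (simp add: \<kappa>_def)
  define \<eta> where "\<eta> = min e (t * \<delta> / 8)"
  have "\<eta> > 0" using \<open>e > 0\<close> t \<open>\<delta> > 0\<close> by (simp add: \<eta>_def)
  obtain n where n: "n \<ge> 1" "mesh n < \<eta> / (4 * K)"
  proof -
    have "\<forall>\<^sub>F n in sequentially. n \<ge> 1 \<and> mesh n < \<eta> / (4 * K)"
      using \<open>\<eta> > 0\<close> \<open>K > 0\<close> by (intro eventually_conj eventually_ge_at_top eventually_mesh_less) auto
    then show ?thesis using that by (auto dest: eventually_happens)
  qed
  have err: "4 * K * mesh n \<le> \<eta>"
    using n(2) \<open>K > 0\<close> by (simp add: field_simps)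
  define L where "L = F + (4 * K + 2 * \<delta>)"
  have "L > 0" using F \<open>K > 0\<close> \<open>\<delta> > 0\<close> by (simp add: L_def)
  have near: "?V y - K * sqdist x y \<le> ?V z - K * sqdist x z + \<eta>"
    if "x \<in> unit_square" "y \<in> unit_square" "z \<in> unit_square" "fst y \<le> fst z" "snd y \<le> snd z"
      "\<bar>fst y - fst z\<bar> \<le> mesh n" "\<bar>snd y - snd z\<bar> \<le> mesh n" for x y z
  proof -
    have "K * sqdist x z \<le> K * (sqdist x y + 4 * mesh n)"
      using sqdist_perturb[OF that(1,2,3,6,7)] \<open>K > 0\<close> by (intro mult_left_mono) auto
    moreover have "?V y \<le> ?V z" using that by (intro value_fun_mono)
    ultimately show ?thesis using err by (simp add: algebra_simps)
  qed
  show ?thesis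
    \<comment> \<open>Seen from \<open>u N\<close>, the maximum of \<open>\<Phi>\<close> is a
      minimum, so the penalty and the linear term enter with reversed signs.\<close>
    using slope_bound_at_touching_below[OF \<open>L > 0\<close> \<open>\<kappa> > 0\<close> finite_grid[of n], of "- K" "- \<delta>"]
      eventually_ge_at_top[of "1::nat"]
  proof eventually_elim
    case (elim N)
    note N = elim(2)
    define \<Phi> where "\<Phi> = (\<lambda>(x, y). ?V y - u N x - K * sqdist x y - \<delta> * (fst x + snd x))"
    show ?case
    proof (rule ballI, rule ccontr)
      fix x0 assume x0: "x0 \<in> grid N" "\<not> ?V x0 \<le> u N x0 + 4 * e"
      have x0sq: "x0 \<in> unit_square" using x0 grid_subset_unit_square by blast
      obtain x y where xy: "x \<in> grid N" "y \<in> grid n"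
        and max: "\<And>x' y'. \<lbrakk>x' \<in> grid N; y' \<in> grid n\<rbrakk> \<Longrightarrow> \<Phi> (x', y') \<le> \<Phi> (x, y)"
        by (rule finite_pairs_maximizer[OF finite_grid[of N] grid_nonempty finite_grid[of n] grid_nonempty, of \<Phi>]) blast
      have sq: "x \<in> unit_square" "y \<in> unit_square" using xy grid_subset_unit_square by blast+
      have sq': "0 \<le> fst x" "0 \<le> snd x" "fst x0 \<le> 1" "snd x0 \<le> 1"
        using sq x0sq by (auto simp: unit_square_def mem_Times_iff)
      have pos: "2 * e < \<Phi> (x, y)"
      proof -
        obtain y0 where y0: "y0 \<in> grid n" "fst x0 \<le> fst y0" "snd x0 \<le> snd y0"
          "\<bar>fst x0 - fst y0\<bar> \<le> mesh n" "\<bar>snd x0 - snd y0\<bar> \<le> mesh n"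
          using unit_square_ceiling_grid[OF x0sq n(1)] by blast
        have "?V x0 \<le> ?V y0 - K * sqdist x0 y0 + \<eta>"
          using near[OF x0sq x0sq _ y0(2-5)] y0(1) grid_subset_unit_square by (auto simp: sqdist_def)
        moreover have "\<delta> * (fst x0 + snd x0) \<le> \<delta> * 2" using sq' \<open>\<delta> > 0\<close> by (intro mult_left_mono) auto
        moreover have "\<eta> \<le> e" by (simp add: \<eta>_def)
        ultimately have "2 * e < \<Phi> (x0, y0)" using x0(2) by (simp add: \<Phi>_def \<delta>_def)
        also have "\<dots> \<le> \<Phi> (x, y)" using max x0 y0 by blast
        finally show ?thesis .
      qed
      have u0: "0 \<le> u N x" using u_nonneg[OF N xy(1)] .
      have pen: "0 \<le> K * sqdist x y" "0 \<le> \<delta> * (fst x + snd x)"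
        using \<open>K > 0\<close> sqdist_nonneg[of x y] \<open>\<delta> > 0\<close> sq' by auto
      have Vy: "e \<le> ?V y" "u N x \<le> F" "K * sqdist x y \<le> F"
        using pos u0 pen \<open>e > 0\<close> V_le(3)[OF sq(2)] by (auto simp: \<Phi>_def)
      have nxy: "norm (x - y) \<le> m"
        by (rule norm_le_of_penalty[OF F(1) m(1)]) (use Vy in \<open>simp add: K_def\<close>)
      have dxy: "\<bar>fst x - fst y\<bar> \<le> m" "\<bar>snd x - snd y\<bar> \<le> m"
        using nxy abs_components_le_norm[of "x - y"] by simp_all
      have y_far: "\<kappa>0 \<le> fst y" "\<kappa>0 \<le> snd y" using far[OF sq(2) Vy(1)] .
      have x_in: "x \<in> inner_grid N"
        using xy(1) y_far dxy m \<open>\<kappa>0 > 0\<close> by (auto simp: inner_grid_iff)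
      have max_x: "\<forall>z\<in>grid N. u N x - - K * sqdist x y - - \<delta> * (fst x + snd x)
          \<le> u N z - - K * sqdist z y - - \<delta> * (fst z + snd z)"
      proof
        fix z assume "z \<in> grid N"
        from max[OF this xy(2)] show "u N x - - K * sqdist x y - - \<delta> * (fst x + snd x)
          \<le> u N z - - K * sqdist z y - - \<delta> * (fst z + snd z)"
          by (simp add: \<Phi>_def)
      qed
      have L_bound: "\<bar>u N x - quad (- K) (- \<delta> - 2 * - K * fst y) (- \<delta> - 2 * - K * snd y) x\<bar> \<le> L"
        using abs_quad_centred_le[OF sq, of "- K" "- \<delta>"] Vy u0 \<open>K > 0\<close> \<open>\<delta> > 0\<close>
        by (simp only: L_def abs_le_iff) simp
      define p1 where "p1 = 2 * K * (fst y - fst x)"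
      define p2 where "p2 = 2 * K * (snd y - snd x)"
      define H where "H v = p1 * fst v + p2 * snd v - f x * sqrt (fst v * snd v)
          - \<delta> * (fst v + snd v) + \<delta> / 8 * norm v" for v :: "real \<times> real"
      have H_A: "0 \<le> H \<alpha>" if "\<alpha> \<in> A" for \<alpha>
      proof -
        have "f x * sqrt (fst \<alpha> * snd \<alpha>) - \<kappa>
          \<le> 2 * - K * ((fst x - fst y) * fst \<alpha> + (snd x - snd y) * snd \<alpha>) + - \<delta> * (fst \<alpha> + snd \<alpha>)"
          by (rule elim(1)[rule_format, OF xy(2) x_in bspec[OF max_x] L_bound that])
        moreover have "\<kappa> \<le> \<delta> / 8 * norm \<alpha>" using a(2)[OF that] \<open>\<delta> > 0\<close> by (simp add: \<kappa>_def)
        ultimately show ?thesis by (simp add: H_def p1_def p2_def algebra_simps)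
      qed
      have H_scale: "H (l *\<^sub>R v) = l * H v" if "0 \<le> l" for l v
      proof -
        have "sqrt (l * fst v * (l * snd v)) = l * sqrt (fst v * snd v)"
        proof -
          have "l * fst v * (l * snd v) = l\<^sup>2 * (fst v * snd v)" by (simp add: power2_eq_square)
          then show ?thesis using that by (simp add: real_sqrt_mult)
        qed
        then show ?thesis using that by (simp add: H_def algebra_simps)
      qed
      have "closed {v. 0 \<le> H v}"
        unfolding H_def by (intro closed_Collect_le continuous_intros)
      moreover have "{l *\<^sub>R \<alpha> | l \<alpha>. 0 \<le> l \<and> \<alpha> \<in> A} \<subseteq> {v. 0 \<le> H v}"
        using H_A H_scale by auto
      ultimately have "closure {l *\<^sub>R \<alpha> | l \<alpha>. 0 \<le> l \<and> \<alpha> \<in> A} \<subseteq> {v. 0 \<le> H v}"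
        by (rule closure_minimal[rotated])
      then have H: "0 \<le> H v" if "0 \<le> fst v" "0 \<le> snd v" for v
        using A1 that by (auto simp: cond_A1_def quadrant_def mem_Times_iff)
      have fx: "0 \<le> f x" using f_nonneg[OF sq(1)] .
      have ny: "t \<le> norm y" using t(2) m y_far(1) abs_components_le_norm(1)[of y] \<open>\<kappa>0 > 0\<close> by linarith
      have fM: "f w \<le> f x + \<omega>" if w: "w \<in> unit_square" "norm (w - y) \<le> t" for w
      proof -
        have "norm (x - w) \<le> norm (x - y) + norm (w - y)"
          using norm_triangle_ineq4[of "x - y" "w - y"] by simp
        also have "\<dots> < \<rho>" using nxy w(2) t(2) m \<rho>(1) by linarith
        finally show ?thesis using \<rho>(2)[OF sq(1) w(1)] by (simp add: abs_less_iff)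
      qed
      have "0 < t * \<delta> / 8" "0 \<le> f x + \<omega>" using t \<open>\<delta> > 0\<close> fx \<open>\<omega> > 0\<close> by auto
      obtain v where v: "0 \<le> fst v" "0 \<le> snd v" "norm v = t" "y - v \<in> unit_square"
        and Vv: "?V y \<le> ?V (y - v) + (f x + \<omega>) * sqrt (fst v * snd v) + t * \<delta> / 8"
        by (rule value_fun_last_step[OF sq(2) t(1) ny \<open>0 < t * \<delta> / 8\<close> \<open>0 \<le> f x + \<omega>\<close> fM])
      obtain y' where y': "y' \<in> grid n" "fst (y - v) \<le> fst y'" "snd (y - v) \<le> snd y'"
          "\<bar>fst (y - v) - fst y'\<bar> \<le> mesh n" "\<bar>snd (y - v) - snd y'\<bar> \<le> mesh n"
        using unit_square_ceiling_grid[OF v(4) n(1)] by blast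
      have "?V (y - v) - K * sqdist x (y - v) \<le> ?V y' - K * sqdist x y' + \<eta>"
        using near[OF sq(1) v(4) _ y'(2-5)] y'(1) grid_subset_unit_square by blast
      also have "?V y' - K * sqdist x y' \<le> ?V y - K * sqdist x y"
        using max[OF xy(1) y'(1)] by (simp add: \<Phi>_def)
      finally have "?V (y - v) - ?V y \<le> K * (sqdist x (y - v) - sqdist x y) + \<eta>"
        by (simp add: algebra_simps)
      moreover have "K * (sqdist x (y - v) - sqdist x y) = - (p1 * fst v + p2 * snd v) + K * t * t"
        unfolding sqdist_shift v(3) by (simp add: p1_def p2_def power2_eq_square algebra_simps)
      moreover have "K * t * t \<le> \<delta> / 8 * t" using tK t by (intro mult_right_mono) auto
      moreover have "\<eta> \<le> \<delta> / 8 * t" by (simp add: \<eta>_def min_le_iff_disj mult.commute)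
      moreover have "\<omega> * sqrt (fst v * snd v) \<le> \<delta> / 8 * t"
        using sqrt_mult_le_norm[OF v(1,2)] v(3) \<open>\<delta> > 0\<close> by (simp add: \<omega>_def)
      moreover have "\<delta> * t \<le> \<delta> * (fst v + snd v)"
        using norm_le_fst_plus_snd[OF v(1,2)] v(3) \<open>\<delta> > 0\<close> by simp
      moreover have "f x * sqrt (fst v * snd v) + \<delta> * (fst v + snd v) \<le> p1 * fst v + p2 * snd v + \<delta> / 8 * t"
        using H[OF v(1,2)] by (simp add: H_def v(3))
      moreover have "(f x + \<omega>) * sqrt (fst v * snd v) = f x * sqrt (fst v * snd v) + \<omega> * sqrt (fst v * snd v)"
        by (simp add: algebra_simps)
      moreover have "t * \<delta> / 8 = \<delta> / 8 * t" "\<delta> * t = 8 * (\<delta> / 8 * t)" by simp_all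
      moreover have "0 < \<delta> / 8 * t" using t \<open>\<delta> > 0\<close> by simp
      \<comment> \<open>Five errors of at most \<open>\<delta> / 8 * t\<close> each (consistency,
        curvature of the penalty, rounding, oscillation of \<open>f\<close>, near-optimality of the
        path) cannot balance \<open>\<delta> * t\<close>.\<close>
      ultimately show False using Vv by linarith
    qed
  qed
qed

lemma solution_converges_uniformly:
  "(\<lambda>N. MAX x\<in>grid N. \<bar>u N x - value_fun f x\<bar>) \<longlonglongrightarrow> 0"
proof (rule tendstoI)
  fix e :: real assume "e > 0"
  then have "e / 8 > 0" by simp
  show "\<forall>\<^sub>F N in sequentially. dist (MAX x\<in>grid N. \<bar>u N x - value_fun f x\<bar>) 0 < e"
    using solution_le_value_fun[OF \<open>e / 8 > 0\<close>] value_fun_le_solution[OF \<open>e / 8 > 0\<close>]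
  proof eventually_elim
    case (elim N)
    define M where "M = (\<lambda>x. \<bar>u N x - value_fun f x\<bar>) ` grid N"
    have fin: "finite M" "M \<noteq> {}" using finite_grid grid_nonempty by (auto simp: M_def)
    have "\<forall>c\<in>M. 0 \<le> c \<and> c \<le> e / 2"
    proof
      fix c assume "c \<in> M"
      then obtain x where x: "x \<in> grid N" "c = \<bar>u N x - value_fun f x\<bar>" by (auto simp: M_def)
      show "0 \<le> c \<and> c \<le> e / 2"
        using bspec[OF elim(1) x(1)] bspec[OF elim(2) x(1)] x(2) by linarith
    qed
    then have "0 \<le> Max M" "Max M \<le> e / 2" using Max_in[OF fin] by auto
    then show "dist (MAX x\<in>grid N. \<bar>u N x - value_fun f x\<bar>) 0 < e"
      using \<open>e > 0\<close> by (simp add: M_def dist_real_def)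
  qed
qed

end

theorem theorem4:
  fixes f :: "real \<times> real \<Rightarrow> real"
    and A :: "(real \<times> real) set"
    and g :: approximations
    and u\<^sub>h :: "nat \<Rightarrow> real \<times> real \<Rightarrow> real"
  assumes "continuous_on unit_square f"
    and "\<And>x. x \<in> unit_square \<Longrightarrow> 0 \<le> f x"
    and "cond_A1 A" and "cond_A2 A"
    and "cond_G1 A g" and "cond_G2 A g" and "cond_G3 A g" and "cond_G4 A g"
    and "\<And>N. N \<ge> 1 \<Longrightarrow> the_scheme_solution f A g N (u\<^sub>h N)"
  shows "(\<lambda>N. MAX x\<in>grid N. \<bar>u\<^sub>h N x - value_fun f x\<bar>) \<longlonglongrightarrow> 0"
proof -
  interpret scheme_solutions f A g u\<^sub>h
    using assms by unfold_locales auto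
  show ?thesis by (rule solution_converges_uniformly)
qed

end
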